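(* Assume that each $f_i:\mathbb{R}^n\to\mathbb{R}$, $i=1,\dots,N$, is continuously differentiable and strongly convex with $l$-Lipschitz continuous gradient; that the problem $\min\sum_{i=1}^N f_i(x_i)$ subject to $\sum_{i=1}^N x_i=\sum_{i=1}^N d_i$ has a finite optimal allocation $X^*$; that the attack signals $u_i^a(t),\lambda_i^a(t),z_i^a(t)\in\mathbb{R}^n$ and their time derivatives are bounded on $[0,\infty)$ for all $i$; and that $\frac{d}{dt}g_i(x_i(t))$ exists and is bounded for all $i$. Consider the resilient distributed resource allocation algorithm (described in the context) with the linear extended state observer, i.e. $a_1,a_2>0$ and, for a parameter $w_0>0$, $$h_1(\gamma_i-\hat\gamma_i)=w_0(\gamma_i-\hat\gamma_i),\qquad h_2(\gamma_i-\hat\gamma_i)=w_0^2(\gamma_i-\hat\gamma_i).$$ Then the algorithm converges to a small neighborhood of $X^*$ in the sense that $$\limsup_{t\to\infty}\|X(t)-X^*\|=O\!\left(\tfrac{1}{w_0}\right)\quad\text{as } w_0\to\infty,$$ that is, there are constants $C,\bar w>0$ independent of $w_0$ such that $\limsup_{t\to\infty}\|X(t)-X^*\|\le C/w_0$ for all $w_0\ge\bar w$.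
   Context: $N$ agents have decisions $x_i\in\mathbb{R}^n$, cost functions $f_i$ and resource data $d_i\in\mathbb{R}^n$; $X=\mathrm{col}(x_1,\dots,x_N)$ is the stacked vector ($\mathrm{col}$ denotes stacking), and $\lambda_i,z_i\in\mathbb{R}^n$ are auxiliary states. Agent $i$ has dynamics $\dot x_i=g_i(x_i)+(\text{input})$ with $g_i:\mathbb{R}^n\to\mathbb{R}^n$ a (possibly unknown) nonlinear function. The communication graph on $\{1,\dots,N\}$ is fixed, undirected and connected, with symmetric weights $a_{ij}=a_{ji}\ge0$ ($a_{ij}>0$ exactly when $(i,j)$ is an edge). From the attack signals put $$\kappa_{i1}=u_i^a,\qquad \kappa_{i2}=-\sum_{j=1}^N a_{ij}(\lambda_i^a-\lambda_j^a)-\sum_{j=1}^N a_{ij}(z_i^a-z_j^a),\qquad \kappa_{i3}=\sum_{j=1}^N a_{ij}(\lambda_i^a-\lambda_j^a).$$ Let $\gamma_i=\mathrm{col}(x_i,\lambda_i,z_i)$ and $\kappa_i=\mathrm{col}(\kappa_{i1}+g_i(x_i),\kappa_{i2},\kappa_{i3})$ in $\mathbb{R}^{3n}$. Their estimates $\hat\gamma_i=\mathrm{col}(\hat x_i,\hat\lambda_i,\hat z_i)$ and $\hat\kappa_i=\mathrm{col}(\hat\kappa_{i1}+\hat g_i,\hat\kappa_{i2},\hat\kappa_{i3})$ (the first block $\hat\kappa_{i1}+\hat g_i$ is a single $\mathbb{R}^n$-valued state) are generated by the extended state observer (ESO) $$\dot{\hat\gamma}_i=\hat\kappa_i+u_{io}+a_1h_1(\gamma_i-\hat\gamma_i),\qquad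 \dot{\hat\kappa}_i=a_2h_2(\gamma_i-\hat\gamma_i),$$ where $$u_{io}=\begin{bmatrix}-\nabla f_i(x_i)-\lambda_i-\hat\kappa_{i1}-\hat g_i\\ -\sum_{j} a_{ij}(\lambda_i-\lambda_j)-\sum_{j} a_{ij}(z_i-z_j)+x_i-d_i-\hat\kappa_{i2}\\ \sum_{j} a_{ij}(\lambda_i-\lambda_j)-\hat\kappa_{i3}\end{bmatrix}.$$ The resilient distributed resource allocation algorithm is the closed loop of this observer with $$\begin{aligned}\dot x_i&=g_i(x_i)-\nabla f_i(x_i)-\lambda_i+\kappa_{i1}-\hat\kappa_{i1}-\hat g_i,\\ \dot\lambda_i&=-\sum_{j} a_{ij}(\lambda_i-\lambda_j)-\sum_{j} a_{ij}(z_i-z_j)+x_i-d_i+\kappa_{i2}-\hat\kappa_{i2},\\ \dot z_i&=\sum_{j} a_{ij}(\lambda_i-\lambda_j)+\kappa_{i3}-\hat\kappa_{i3},\end{aligned}$$ i.e. $\dot\gamma_i=\kappa_i+u_{io}$. Solutions are considered on $[0,\infty)$, and the bound on $\frac{d}{dt}g_i(x_i(t))$ along solutions is understood to be independent of $w_0$. *)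

theory Defs
  imports "HOL-Analysis.Analysis"
begin

text \<open>The agents are indexed by a finite type \<open>'m\<close> and decisions live in \<open>real ^ 'n\<close>. A stacked
  vector such as \<open>X = col(x_1,...,x_N)\<close> is an element of \<open>(real ^ 'n) ^ 'm\<close>, whose norm is the
  Euclidean norm of the stacked vector; likewise for \<open>col(x_i, lam_i, z_i)\<close> in the product type
  below.\<close>

type_synonym 'n triple = "(real ^ 'n) \<times> (real ^ 'n) \<times> (real ^ 'n)"

definition grad :: "('a::real_inner \<Rightarrow> real) \<Rightarrow> 'a \<Rightarrow> 'a" where
  "grad f x = (THE D. GDERIV f x :> D)"

definition continuously_differentiable :: "('a::euclidean_space \<Rightarrow> real) \<Rightarrow> bool" where
  "continuously_differentiable f \<longleftrightarrow>
     (\<forall>x. f differentiable (at x)) \<and> continuous_on UNIV (grad f)"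

definition strongly_convex :: "('a::real_inner \<Rightarrow> real) \<Rightarrow> bool" where
  "strongly_convex f \<longleftrightarrow> (\<exists>\<mu>>0. \<forall>x y. \<forall>t\<in>{0..1}.
     f (t *\<^sub>R x + (1 - t) *\<^sub>R y)
       \<le> t * f x + (1 - t) * f y - \<mu> / 2 * t * (1 - t) * (norm (x - y))\<^sup>2)"

definition optimal_allocation ::
  "('m \<Rightarrow> real ^ 'n \<Rightarrow> real) \<Rightarrow> real ^ 'n ^ 'm \<Rightarrow> real ^ 'n ^ 'm \<Rightarrow> bool" where
  "optimal_allocation f d X \<longleftrightarrow>
     is_arg_min (\<lambda>Y. \<Sum>i\<in>UNIV. f i (Y $ i)) (\<lambda>Y. (\<Sum>i\<in>UNIV. Y $ i) = (\<Sum>i\<in>UNIV. d $ i)) X"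

text \<open>Edges are the pairs of positive weight. Self-loops are not excluded: a diagonal weight never
  contributes to the dynamics.\<close>

definition connected_undirected_weights :: "('m \<Rightarrow> 'm \<Rightarrow> real) \<Rightarrow> bool" where
  "connected_undirected_weights a \<longleftrightarrow>
     (\<forall>i j. a i j = a j i) \<and> (\<forall>i j. 0 \<le> a i j) \<and>
     (\<forall>i j. (i, j) \<in> {(k, l). 0 < a k l}\<^sup>*)"

definition disagreement :: "('m \<Rightarrow> 'm \<Rightarrow> real) \<Rightarrow> real ^ 'n ^ 'm \<Rightarrow> 'm \<Rightarrow> real ^ 'n" where
  "disagreement a v i = (\<Sum>j\<in>UNIV. a i j *\<^sub>R (v $ i - v $ j))"

definition bounded_with_bounded_derivative :: "(real \<Rightarrow> 'a::real_normed_vector) \<Rightarrow> bool" where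
  "bounded_with_bounded_derivative s \<longleftrightarrow>
     bounded (s ` {0..}) \<and>
     (\<exists>s'. (\<forall>t\<ge>0. (s has_vector_derivative s' t) (at t within {0..})) \<and> bounded (s' ` {0..}))"

text \<open>Attack contributions at agent \<open>i\<close>, from the values \<open>u\<close>, \<open>l\<close>, \<open>z\<close> of the attack signals.\<close>

definition kappa1 :: "real ^ 'n ^ 'm \<Rightarrow> 'm \<Rightarrow> real ^ 'n" where
  "kappa1 u i = u $ i"

definition kappa2 ::
  "('m \<Rightarrow> 'm \<Rightarrow> real) \<Rightarrow> real ^ 'n ^ 'm \<Rightarrow> real ^ 'n ^ 'm \<Rightarrow> 'm \<Rightarrow> real ^ 'n" where
  "kappa2 a l z i = - disagreement a l i - disagreement a z i"

definition kappa3 :: "('m \<Rightarrow> 'm \<Rightarrow> real) \<Rightarrow> real ^ 'n ^ 'm \<Rightarrow> 'm \<Rightarrow> real ^ 'n" where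
  "kappa3 a l i = disagreement a l i"

text \<open>The argument \<open>k\<close> is the estimate of \<open>kappa_i\<close>; its first block is the single state estimating
  \<open>kappa_i1 + g_i(x_i)\<close>.\<close>

definition observer_input ::
  "('m \<Rightarrow> real ^ 'n \<Rightarrow> real) \<Rightarrow> real ^ 'n ^ 'm \<Rightarrow> ('m \<Rightarrow> 'm \<Rightarrow> real)
    \<Rightarrow> real ^ 'n ^ 'm \<Rightarrow> real ^ 'n ^ 'm \<Rightarrow> real ^ 'n ^ 'm \<Rightarrow> 'n triple \<Rightarrow> 'm \<Rightarrow> 'n triple" where
  "observer_input f d a x l z k i =
     (- grad (f i) (x $ i) - l $ i - fst k,
      - disagreement a l i - disagreement a z i + x $ i - d $ i - fst (snd k),
      disagreement a l i - snd (snd k))"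

text \<open>Closed loop of the agents and the extended state observer on \<open>[0,\<infinity>)\<close>. The functions
  \<open>gh\<close> and \<open>kh\<close> are the estimates of \<open>gamma = (x, l, z)\<close> and of \<open>kappa\<close>; \<open>ua\<close>, \<open>la\<close>, \<open>za\<close> are the
  attack signals.\<close>

definition resilient_allocation_solution ::
  "('m \<Rightarrow> real ^ 'n \<Rightarrow> real) \<Rightarrow> real ^ 'n ^ 'm \<Rightarrow> ('m \<Rightarrow> 'm \<Rightarrow> real)
    \<Rightarrow> ('m \<Rightarrow> real ^ 'n \<Rightarrow> real ^ 'n)
    \<Rightarrow> (real \<Rightarrow> real ^ 'n ^ 'm) \<Rightarrow> (real \<Rightarrow> real ^ 'n ^ 'm) \<Rightarrow> (real \<Rightarrow> real ^ 'n ^ 'm)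
    \<Rightarrow> real \<Rightarrow> real \<Rightarrow> ('n triple \<Rightarrow> 'n triple) \<Rightarrow> ('n triple \<Rightarrow> 'n triple)
    \<Rightarrow> (real \<Rightarrow> real ^ 'n ^ 'm) \<Rightarrow> (real \<Rightarrow> real ^ 'n ^ 'm) \<Rightarrow> (real \<Rightarrow> real ^ 'n ^ 'm)
    \<Rightarrow> (real \<Rightarrow> 'n triple ^ 'm) \<Rightarrow> (real \<Rightarrow> 'n triple ^ 'm) \<Rightarrow> bool" where
  "resilient_allocation_solution f d a g ua la za a1 a2 h1 h2 x l z gh kh \<longleftrightarrow>
     (\<forall>i. \<forall>t\<ge>0.
        ((\<lambda>s. x s $ i) has_vector_derivative
           g i (x t $ i) - grad (f i) (x t $ i) - l t $ i
             + kappa1 (ua t) i - fst (kh t $ i)) (at t within {0..}) \<and>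
        ((\<lambda>s. l s $ i) has_vector_derivative
           - disagreement a (l t) i - disagreement a (z t) i + x t $ i - d $ i
             + kappa2 a (la t) (za t) i - fst (snd (kh t $ i))) (at t within {0..}) \<and>
        ((\<lambda>s. z s $ i) has_vector_derivative
           disagreement a (l t) i + kappa3 a (la t) i - snd (snd (kh t $ i))) (at t within {0..}) \<and>
        ((\<lambda>s. gh s $ i) has_vector_derivative
           kh t $ i + observer_input f d a (x t) (l t) (z t) (kh t $ i) i
             + a1 *\<^sub>R h1 ((x t $ i, l t $ i, z t $ i) - gh t $ i)) (at t within {0..}) \<and>
        ((\<lambda>s. kh s $ i) has_vector_derivative
           a2 *\<^sub>R h2 ((x t $ i, l t $ i, z t $ i) - gh t $ i)) (at t within {0..}))"

definition drift_rate_bounded ::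
  "('m \<Rightarrow> real ^ 'n \<Rightarrow> real ^ 'n) \<Rightarrow> (real \<Rightarrow> real ^ 'n ^ 'm) \<Rightarrow> real \<Rightarrow> bool" where
  "drift_rate_bounded g x M \<longleftrightarrow>
     (\<forall>i. \<forall>t\<ge>0. \<exists>D. ((\<lambda>s. g i (x s $ i)) has_vector_derivative D) (at t within {0..}) \<and> norm D \<le> M)"

end

theory Submission
  imports Defs
begin

text \<open>The observer error decouples from the plant. With \<open>q_i = kappa_i - kh_i\<close> and the rescaled state
  error \<open>p_i = w_0 (gamma_i - gh_i)\<close>, the pair \<open>(p_i, q_i)\<close> obeys a Hurwitz linear system sped up by
  \<open>w_0\<close> and forced by the bounded signal \<open>kappa_i'\<close>, hence \<open>q_i\<close> is eventually \<open>O(1/w_0)\<close>.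

  In deviations from the KKT point the plant is a saddle-point flow with input \<open>q\<close>. Only \<open>Lap z\<close>
  enters the dynamics and the mean of \<open>z\<close> may drift, so \<open>z\<close> is replaced by its mean-free part, on
  which the Laplacian is coercive. Adding the small cross terms
  \<open>\<delta>\<^sup>2 \<langle>x, l\<rangle> + \<delta>\<^sup>3 \<langle>l, z\<rangle>\<close> to the squared distance gives a strict Lyapunov function, so \<open>x\<close> is
  eventually bounded by a multiple of the input bound.\<close>

section \<open>Lyapunov decay and the observer error\<close>

text \<open>Differentiability is a limit of remainder quotients, and limits of stacked vectors can
  be taken block by block.\<close>

lemma has_vector_derivative_vec:
  fixes f :: "real \<Rightarrow> 'a::real_normed_vector ^ 'm::finite"
  assumes "\<And>i. ((\<lambda>t. f t $ i) has_vector_derivative D $ i) (at x within S)"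
  shows "(f has_vector_derivative D) (at x within S)"
  unfolding has_vector_derivative_def has_derivative_within
proof (intro conjI bounded_linear_scaleR_left vec_tendstoI)
  show "((\<lambda>y. ((1 / norm (y - x)) *\<^sub>R (f y - (f x + (y - x) *\<^sub>R D))) $ i) \<longlongrightarrow> 0 $ i) (at x within S)" for i
    using assms[of i] unfolding has_vector_derivative_def has_derivative_within by simp
qed

text \<open>A Gronwall estimate, with a one-sided derivative at the initial time. Up to a decaying
  transient, \<open>W\<close> stays below the level \<open>b / c\<close>; doubling that level
  swallows the transient after finite time.\<close>

lemma eventually_le_of_linear_decay:
  fixes W :: "real \<Rightarrow> real"
  assumes "c > 0" "b > 0"
    and der: "\<And>t. t \<ge> T \<Longrightarrow> \<exists>D. (W has_real_derivative D) (at t within {T..}) \<and> D \<le> b - c * W t"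
  shows "eventually (\<lambda>t. W t \<le> 2 * b / c) at_top"
proof -
  \<comment> \<open>Multiplying the excess over \<open>b / c\<close> by the integrating factor turns
    the differential inequality into monotonicity of \<open>u\<close>.\<close>
  define u where "u t = (W t - b / c) * exp (c * (t - T))" for t
  have mono: "u t \<le> u T" if "t \<ge> T" for t
  proof (rule DERIV_nonpos_imp_decreasing_open[OF that])
    have der_u: "\<exists>D. (u has_real_derivative D) (at s within {T..}) \<and> D \<le> 0" if "s \<ge> T" for s
    proof -
      obtain D where D: "(W has_real_derivative D) (at s within {T..})" "D \<le> b - c * W s"
        using der \<open>s \<ge> T\<close> by blast
      have "(u has_real_derivative (D + c * (W s - b / c)) * exp (c * (s - T))) (at s within {T..})"
        unfolding u_def by (auto intro!: derivative_eq_intros D(1) simp: algebra_simps)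
      moreover have "(D + c * (W s - b / c)) * exp (c * (s - T)) \<le> 0"
        using D(2) \<open>c > 0\<close> by (intro mult_nonpos_nonneg) (auto simp: right_diff_distrib)
      ultimately show ?thesis by blast
    qed
    show "\<exists>D. (u has_real_derivative D) (at s) \<and> D \<le> 0" if "T < s" "s < t" for s
    proof -
      have "at s within {T..} = at s"
        using that by (intro at_within_interior) simp
      then show ?thesis using der_u[of s] that by auto
    qed
    have "continuous_on {T..} u"
      unfolding continuous_on_eq_continuous_within
      using der_u by (metis DERIV_continuous atLeast_iff)
    then show "continuous_on {T..t} u" by (rule continuous_on_subset) auto
  qed
  have "((\<lambda>t. (W T - b / c) * exp (- (c * (t - T)))) \<longlongrightarrow> 0) at_top"
    by (intro tendsto_mult_right_zero filterlim_compose[OF exp_at_bot]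
        filterlim_uminus_at_bot_at_top[THEN filterlim_compose]
        filterlim_tendsto_pos_mult_at_top[OF tendsto_const \<open>c > 0\<close>]
        filterlim_tendsto_add_at_top[OF tendsto_const, of _ _ "-T", simplified] filterlim_ident)
  then have "eventually (\<lambda>t. (W T - b / c) * exp (- (c * (t - T))) < b / c) at_top"
    using assms by (intro order_tendstoD(2)[of _ 0]) auto
  moreover have "eventually (\<lambda>t. t \<ge> T) at_top" by (rule eventually_ge_at_top)
  ultimately show ?thesis
  proof eventually_elim
    case (elim t)
    have "W t - b / c = u t * exp (- (c * (t - T)))"
      by (simp add: u_def exp_minus)
    also have "\<dots> \<le> u T * exp (- (c * (t - T)))"
      using mono[OF elim(2)] by simp
    also have "\<dots> < b / c" using elim(1) by (simp add: u_def)
    finally show ?case by simp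
  qed
qed

section \<open>Quadratic Lyapunov estimate for the observer error\<close>

lemma has_real_derivative_inner:
  fixes f h :: "real \<Rightarrow> 'a::real_inner"
  assumes "(f has_vector_derivative f') (at t within S)" "(h has_vector_derivative h') (at t within S)"
  shows "((\<lambda>s. f s \<bullet> h s) has_real_derivative f t \<bullet> h' + f' \<bullet> h t) (at t within S)"
  using bounded_bilinear.has_vector_derivative[OF bounded_bilinear_inner assms]
  by (simp add: has_real_derivative_iff_has_vector_derivative)

text \<open>Young's inequality, from the square of \<open>e * a - b\<close>.\<close>

lemma two_mult_le_weighted_squares:
  fixes a b e :: real
  assumes "e > 0"
  shows "2 * a * b \<le> e * a\<^sup>2 + b\<^sup>2 / e"
proof -
  have "0 \<le> (e * a - b)\<^sup>2 / e" using assms by simp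
  also have "\<dots> = e * a\<^sup>2 + b\<^sup>2 / e - 2 * a * b"
    using assms by (simp add: field_simps power2_eq_square)
  finally show ?thesis by simp
qed

text \<open>With \<open>p = w e\<close> the system reads \<open>p' = w (q - a1 p)\<close>,
  \<open>q' = r - a2 w p\<close>: the decay rate grows with \<open>w\<close> while the forcing
  \<open>r\<close> stays bounded. \<open>C\<close> is fixed before \<open>w\<close> and all signals,
  which is what makes the final estimate uniform in \<open>w0\<close>.\<close>

lemma extended_state_observer_error:
  fixes a1 a2 K :: real
  assumes "a1 > 0" "a2 > 0" "K > 0"
  shows "\<exists>C>0. \<forall>w>0. \<forall>e q r :: real \<Rightarrow> 'a::real_inner.
    (\<forall>t\<ge>0. (e has_vector_derivative q t - (a1 * w) *\<^sub>R e t) (at t within {0..})) \<longrightarrow>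
    (\<forall>t\<ge>0. (q has_vector_derivative r t - (a2 * w\<^sup>2) *\<^sub>R e t) (at t within {0..})) \<longrightarrow>
    (\<forall>t\<ge>0. norm (r t) \<le> K) \<longrightarrow>
    eventually (\<lambda>t. norm (q t) \<le> C / w) at_top"
proof -
  \<comment> \<open>The first entry lets the damping of \<open>p\<close> absorb what the cross term
    of \<open>V\<close> adds to it. The other entries keep \<open>V\<close> comparable to the sum of
    squares.\<close>
  define \<beta> where "\<beta> = min (a1 * a2 / (a1\<^sup>2 + 2 * a2)) (min 1 (a2 / 4))"
  have \<beta>: "\<beta> > 0" "\<beta> \<le> 1" "\<beta> \<le> a2 / 4" "\<beta> * (a1\<^sup>2 + 2 * a2) \<le> a1 * a2"
  proof -
    have p: "a1\<^sup>2 + 2 * a2 > 0" using assms by (simp add: pos_add_strict)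
    show "\<beta> > 0" using assms p by (simp add: \<beta>_def)
    show "\<beta> \<le> 1" "\<beta> \<le> a2 / 4" unfolding \<beta>_def by linarith+
    have "\<beta> \<le> a1 * a2 / (a1\<^sup>2 + 2 * a2)" by (simp add: \<beta>_def)
    then show "\<beta> * (a1\<^sup>2 + 2 * a2) \<le> a1 * a2" using p by (simp add: field_simps)
  qed
  define m where "m = min (a1 * a2) \<beta>"
  have m: "m > 0" "m \<le> a1 * a2" "m \<le> \<beta>" using assms \<beta> by (auto simp: m_def)
  define n where "n = 2 * max a2 1"
  have n: "n > 0" "n \<ge> 2 * a2" "n \<ge> 2" by (auto simp: n_def)
  \<comment> \<open>Sized so that each of the two forcing terms, \<open>q\<close> against
    \<open>r\<close> and \<open>p\<close> against \<open>r\<close>, costs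
    \<open>R / (2 * w)\<close>.\<close>
  define R where "R = 4 * K\<^sup>2 / m"
  have R: "R > 0" using m assms by (simp add: R_def)
  \<comment> \<open>The decay rate is \<open>w * m / (2 * n)\<close> and the forcing
    \<open>R / w\<close>, so \<open>V\<close> is eventually at most
    \<open>4 * R * n / (m * w^2)\<close>. The squared norm of \<open>q\<close> is at most twice
    that.\<close>
  define C where "C = sqrt (8 * R * n / m)"
  have C: "C > 0" "C\<^sup>2 = 8 * R * n / m" using R n m by (auto simp: C_def)
  have "eventually (\<lambda>t. norm (q t) \<le> C / w) at_top"
    if w: "w > 0"
      and de: "\<forall>t\<ge>0. (e has_vector_derivative q t - (a1 * w) *\<^sub>R e t) (at t within {0..})"
      and dq: "\<forall>t\<ge>0. (q has_vector_derivative r t - (a2 * w\<^sup>2) *\<^sub>R e t) (at t within {0..})"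
      and r: "\<forall>t\<ge>0. norm (r t) \<le> K"
    for w and e q r :: "real \<Rightarrow> 'a"
  proof -
    define p where "p t = w *\<^sub>R e t" for t
    \<comment> \<open>The weight \<open>a2\<close> cancels the coupling of \<open>p\<close> and
      \<open>q\<close> in the derivative. The first two terms alone give no damping of
      \<open>q\<close>; the cross term supplies \<open>- 2 * \<beta> * w\<close> times its squared
      norm.\<close>
    define V where "V t = a2 * (p t \<bullet> p t) + q t \<bullet> q t - 2 * \<beta> * (p t \<bullet> q t)" for t
    have cross: "2 * \<bar>p t \<bullet> q t\<bar> \<le> s * (p t \<bullet> p t) + (q t \<bullet> q t) / s" if "s > 0" for s t
      using two_mult_le_weighted_squares[OF that, of "norm (p t)" "norm (q t)"]
        Cauchy_Schwarz_ineq2[of "p t" "q t"]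
      by (simp add: power2_norm_eq_inner)
    have Vb: "q t \<bullet> q t \<le> 2 * V t \<and> V t \<le> n * (p t \<bullet> p t + q t \<bullet> q t)" for t
    proof -
      have "\<beta> * (2 * \<bar>p t \<bullet> q t\<bar>) \<le> \<beta> * (2 * \<beta> * (p t \<bullet> p t) + (q t \<bullet> q t) / (2 * \<beta>))"
        using \<beta> by (intro mult_left_mono cross) auto
      also have "\<dots> = 2 * \<beta>\<^sup>2 * (p t \<bullet> p t) + (q t \<bullet> q t) / 2"
        using \<beta> by (simp add: field_simps power2_eq_square)
      also have "\<dots> \<le> a2 / 2 * (p t \<bullet> p t) + (q t \<bullet> q t) / 2"
      proof -
        have "2 * \<beta>\<^sup>2 \<le> 2 * \<beta>" using \<beta> by (simp add: power2_eq_square mult_left_le)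
        also have "\<dots> \<le> a2 / 2" using \<beta> by simp
        finally show ?thesis by (intro add_right_mono mult_right_mono) auto
      qed
      finally have 1: "2 * \<beta> * \<bar>p t \<bullet> q t\<bar> \<le> a2 / 2 * (p t \<bullet> p t) + (q t \<bullet> q t) / 2" by simp
      have 2: "\<bar>2 * \<beta> * (p t \<bullet> q t)\<bar> = 2 * \<beta> * \<bar>p t \<bullet> q t\<bar>" using \<beta> by (simp add: abs_mult)
      have 3: "0 \<le> a2 * (p t \<bullet> p t)" using assms by simp
      have 4: "2 * a2 * (p t \<bullet> p t) \<le> n * (p t \<bullet> p t)" "2 * (q t \<bullet> q t) \<le> n * (q t \<bullet> q t)"
        using n by (intro mult_right_mono; simp)+
      have 5: "0 \<le> q t \<bullet> q t" by simp
      show ?thesis unfolding V_def using 1 2 3 4 5 by (simp add: distrib_left) linarith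
    qed
    have "eventually (\<lambda>t. V t \<le> 2 * (R / w) / (w * m / (2 * n))) at_top"
    proof (rule eventually_le_of_linear_decay)
      show "w * m / (2 * n) > 0" "R / w > 0" using w m n R by auto
      show "\<exists>D. (V has_real_derivative D) (at t within {0..}) \<and> D \<le> R / w - w * m / (2 * n) * V t"
        if t: "t \<ge> 0" for t
      proof -
        have dp: "(p has_vector_derivative w *\<^sub>R (q t - a1 *\<^sub>R p t)) (at t within {0..})"
          unfolding p_def using de t
          by (auto intro!: derivative_eq_intros simp: algebra_simps)
        have dq': "(q has_vector_derivative r t - (a2 * w) *\<^sub>R p t) (at t within {0..})"
          using dq t by (simp add: p_def power2_eq_square mult.assoc)
        define D where "D = a2 * (p t \<bullet> (w *\<^sub>R (q t - a1 *\<^sub>R p t)) + (w *\<^sub>R (q t - a1 *\<^sub>R p t)) \<bullet> p t)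
          + (q t \<bullet> (r t - (a2 * w) *\<^sub>R p t) + (r t - (a2 * w) *\<^sub>R p t) \<bullet> q t)
          - 2 * \<beta> * (p t \<bullet> (r t - (a2 * w) *\<^sub>R p t) + (w *\<^sub>R (q t - a1 *\<^sub>R p t)) \<bullet> q t)"
        have "(V has_real_derivative D) (at t within {0..})"
          unfolding V_def D_def
          by (intro DERIV_add DERIV_diff DERIV_cmult has_real_derivative_inner dp dq')
        moreover have "D \<le> R / w - w * m / (2 * n) * V t"
        proof -
          let ?P = "p t \<bullet> p t" and ?Q = "q t \<bullet> q t"
          define E where "E = - (2 * a1 * a2) * ?P + 2 * \<beta> * a2 * ?P - 2 * \<beta> * ?Q
              + \<beta> * (2 * (a1 * (p t \<bullet> q t)))"
          have D: "D = w * E + 2 * (q t \<bullet> r t) - 2 * \<beta> * (p t \<bullet> r t)"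
            unfolding D_def E_def
            by (simp add: inner_diff_left inner_diff_right inner_commute[of "q t" "p t"]
                inner_commute[of "r t" "q t"] inner_commute[of "r t" "p t"] algebra_simps)
          have "2 * (a1 * (p t \<bullet> q t)) \<le> a1\<^sup>2 * ?P + ?Q"
          proof -
            have "a1 * (2 * \<bar>p t \<bullet> q t\<bar>) \<le> a1 * (a1 * ?P + ?Q / a1)"
              using assms by (intro mult_left_mono cross) auto
            also have "\<dots> = a1\<^sup>2 * ?P + ?Q" using assms by (simp add: field_simps power2_eq_square)
            finally have "a1 * (2 * \<bar>p t \<bullet> q t\<bar>) \<le> a1\<^sup>2 * ?P + ?Q" .
            moreover have "a1 * (p t \<bullet> q t) \<le> a1 * \<bar>p t \<bullet> q t\<bar>"
              using assms by (intro mult_left_mono) auto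
            ultimately show ?thesis by simp
          qed
          then have "\<beta> * (2 * (a1 * (p t \<bullet> q t))) \<le> \<beta> * (a1\<^sup>2 * ?P + ?Q)"
            using \<beta> by (intro mult_left_mono) auto
          moreover have "\<beta> * (a1\<^sup>2 + 2 * a2) * ?P \<le> a1 * a2 * ?P"
            using \<beta>(4) by (intro mult_right_mono) auto
          moreover have "m * ?P \<le> a1 * a2 * ?P" "m * ?Q \<le> \<beta> * ?Q"
            using m by (intro mult_right_mono; simp)+
          ultimately have "E \<le> - m * (?P + ?Q)"
            unfolding E_def by (simp add: algebra_simps)
          then have main: "w * E \<le> w * (- m * (?P + ?Q))"
            using w by (intro mult_left_mono) auto
          \<comment> \<open>This weight spends half of the damping \<open>w * m\<close> and leaves
            an error of order \<open>1 / w\<close>.\<close>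
          have pert: "2 * \<bar>v \<bullet> r t\<bar> \<le> w * m / 2 * (v \<bullet> v) + R / (2 * w)" for v
          proof -
            have "2 * \<bar>v \<bullet> r t\<bar> \<le> 2 * (norm v * norm (r t))"
              using Cauchy_Schwarz_ineq2[of v "r t"] by simp
            also have "\<dots> \<le> 2 * norm v * K" using r t by (simp add: mult_left_mono)
            also have "\<dots> \<le> w * m / 2 * (norm v)\<^sup>2 + K\<^sup>2 / (w * m / 2)"
              using w m by (intro two_mult_le_weighted_squares) auto
            also have "\<dots> = w * m / 2 * (v \<bullet> v) + R / (2 * w)"
              using w m by (simp add: R_def power2_norm_eq_inner field_simps)
            finally show ?thesis .
          qed
          have "- (2 * \<beta> * (p t \<bullet> r t)) \<le> 2 * \<beta> * \<bar>p t \<bullet> r t\<bar>"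
          proof -
            have "\<beta> * (- (p t \<bullet> r t)) \<le> \<beta> * \<bar>p t \<bullet> r t\<bar>"
              using \<beta> by (intro mult_left_mono) auto
            then show ?thesis by simp
          qed
          also have "\<dots> \<le> 2 * 1 * \<bar>p t \<bullet> r t\<bar>"
            using \<beta> by (intro mult_right_mono mult_left_mono) auto
          finally have "- (2 * \<beta> * (p t \<bullet> r t)) \<le> 2 * \<bar>p t \<bullet> r t\<bar>" by simp
          with main D pert[of "q t"] pert[of "p t"]
          have "D \<le> w * (- m * (?P + ?Q)) + (w * m / 2 * ?Q + R / (2 * w)) + (w * m / 2 * ?P + R / (2 * w))"
            by linarith
          also have "\<dots> = R / w - w * m / 2 * (?P + ?Q)"
            using w by (simp add: field_simps)
          also have "\<dots> \<le> R / w - w * m / (2 * n) * V t"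
          proof -
            have "w * m / (2 * n) * V t \<le> w * m / (2 * n) * (n * (?P + ?Q))"
              using Vb w m n by (intro mult_left_mono) auto
            also have "\<dots> = w * m / 2 * (?P + ?Q)" using n by simp
            finally show ?thesis by simp
          qed
          finally show ?thesis .
        qed
        ultimately show ?thesis by blast
      qed
    qed
    then show ?thesis
    proof eventually_elim
      case (elim t)
      have "(norm (q t))\<^sup>2 \<le> 2 * V t" using Vb by (simp add: power2_norm_eq_inner)
      also have "\<dots> \<le> 2 * (2 * (R / w) / (w * m / (2 * n)))" using elim by simp
      also have "\<dots> = (C / w)\<^sup>2"
        using w m n by (simp add: power_divide C(2)) (simp add: field_simps power2_eq_square)
      finally show ?case by (rule power2_le_imp_le) (use C w in auto)
    qed
  qed
  then show ?thesis using C(1) by blast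
qed

section \<open>Perturbed saddle-point flow\<close>

text \<open>Young's inequality scaled so that one product uses up a quarter of a damping term
  \<open>c * v^2\<close>.\<close>

lemma mult_le_weighted_squares:
  fixes u v c :: real
  assumes "c > 0"
  shows "u * v \<le> u\<^sup>2 / c + c / 4 * v\<^sup>2"
proof -
  have "2 * v * u \<le> c / 2 * v\<^sup>2 + u\<^sup>2 / (c / 2)"
    using assms by (intro two_mult_le_weighted_squares) simp
  then show ?thesis using assms by (simp add: field_simps)
qed

text \<open>\<open>X\<close>, \<open>Y\<close>, \<open>Z\<close> stand for the norms of the three
  states, damped at orders \<open>1\<close>, \<open>\<delta>^2\<close> and
  \<open>\<delta>^3\<close>. Every product is split so that each square is charged to the damping of
  its own state: half of \<open>\<mu>\<close> pays for \<open>X^2\<close>, half of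
  \<open>\<delta>^2\<close> for \<open>Y^2\<close>, three quarters of \<open>\<delta>^3 * c\<close>
  for \<open>Z^2\<close>, and \<open>m\<close> lies below what remains. Since \<delta> is at most 1,
  the input terms add up to at most three copies.\<close>

lemma saddle_dissipation_scalar:
  fixes \<mu> L B c \<delta> r X Y Z :: real
  assumes c: "c > 0" and nn: "L \<ge> 0" "B \<ge> 0" "r \<ge> 0" "X \<ge> 0" "Y \<ge> 0" "Z \<ge> 0"
    and \<delta>: "0 < \<delta>" "\<delta> \<le> 1"
    and \<delta>G: "\<delta> * ((L + B)\<^sup>2 + B\<^sup>2 / c + 1 + 1 / c) \<le> \<mu> / 2"
    and \<delta>H: "\<delta> * (B\<^sup>2 / c + B) \<le> 1 / 4"
    and m: "m \<le> \<mu> / 2" "m \<le> \<delta>\<^sup>2 / 2" "m \<le> \<delta> ^ 3 * c / 4"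
  shows "- \<mu> * X\<^sup>2 + r * (X + Y + Z)
      + \<delta>\<^sup>2 * ((L + B) * X * Y - Y\<^sup>2 + r * Y + B * X * Z + X\<^sup>2 + r * X)
      + \<delta> ^ 3 * (B * Y * Z - c * Z\<^sup>2 + X * Z + r * Z + B * Y\<^sup>2 + r * Y)
    \<le> - m * (X\<^sup>2 + Y\<^sup>2 + Z\<^sup>2) + 3 * r * (X + Y + Z)"
proof -
  have d2: "\<delta>\<^sup>2 \<le> \<delta>" using \<delta> by (simp add: power2_eq_square mult_left_le)
  have d3: "\<delta> ^ 3 \<le> \<delta>" using \<delta> by (simp add: power_le_one power3_eq_cube mult_le_one mult_left_le)
  have e1: "\<delta>\<^sup>2 * ((L + B) * X * Y) \<le> \<delta> * (L + B)\<^sup>2 * X\<^sup>2 + \<delta>\<^sup>2 * Y\<^sup>2 / 4"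
  proof -
    have "\<delta>\<^sup>2 * ((L + B) * X * Y) \<le> \<delta>\<^sup>2 * (((L + B) * X)\<^sup>2 / 1 + 1 / 4 * Y\<^sup>2)"
      by (intro mult_left_mono mult_le_weighted_squares) auto
    also have "\<dots> = \<delta>\<^sup>2 * ((L + B) * X)\<^sup>2 + \<delta>\<^sup>2 * Y\<^sup>2 / 4" by (simp add: distrib_left)
    also have "\<delta>\<^sup>2 * ((L + B) * X)\<^sup>2 \<le> \<delta> * ((L + B) * X)\<^sup>2"
      using d2 by (intro mult_right_mono) auto
    finally show ?thesis by (simp add: power_mult_distrib)
  qed
  \<comment> \<open>One factor \<delta> is moved onto \<open>Z\<close>, so that Young's inequality
    charges \<open>X^2\<close> at order \<delta> and \<open>Z^2\<close> at order
    \<open>\<delta>^3\<close>, the order of its damping.\<close>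
  have e2: "\<delta>\<^sup>2 * (B * X * Z) \<le> \<delta> * (B\<^sup>2 / c) * X\<^sup>2 + \<delta> ^ 3 * (c / 4 * Z\<^sup>2)"
  proof -
    have "\<delta> * ((B * X) * (\<delta> * Z)) \<le> \<delta> * ((B * X)\<^sup>2 / c + c / 4 * (\<delta> * Z)\<^sup>2)"
      using c \<delta> by (intro mult_left_mono mult_le_weighted_squares) auto
    then show ?thesis by (simp add: power2_eq_square power3_eq_cube distrib_left mult_ac)
  qed
  have e3: "\<delta> ^ 3 * (B * Y * Z) \<le> \<delta>\<^sup>2 * (\<delta> * (B\<^sup>2 / c)) * Y\<^sup>2 + \<delta> ^ 3 * (c / 4 * Z\<^sup>2)"
  proof -
    have "\<delta> ^ 3 * ((B * Y) * Z) \<le> \<delta> ^ 3 * ((B * Y)\<^sup>2 / c + c / 4 * Z\<^sup>2)"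
      using c \<delta> by (intro mult_left_mono mult_le_weighted_squares) auto
    then show ?thesis by (simp add: power2_eq_square power3_eq_cube distrib_left mult_ac)
  qed
  have e4: "\<delta> ^ 3 * (X * Z) \<le> \<delta> * (1 / c) * X\<^sup>2 + \<delta> ^ 3 * (c / 4 * Z\<^sup>2)"
  proof -
    have "\<delta> ^ 3 * (X * Z) \<le> \<delta> ^ 3 * (X\<^sup>2 / c + c / 4 * Z\<^sup>2)"
      using c \<delta> by (intro mult_left_mono mult_le_weighted_squares) auto
    moreover have "\<delta> ^ 3 * (X\<^sup>2 / c) \<le> \<delta> * (X\<^sup>2 / c)"
      using d3 c by (intro mult_right_mono) auto
    ultimately show ?thesis by (simp add: distrib_left)
  qed
  have e5: "\<delta>\<^sup>2 * X\<^sup>2 \<le> \<delta> * X\<^sup>2" using d2 by (intro mult_right_mono) auto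
  have e6: "\<delta> * ((L + B)\<^sup>2 + B\<^sup>2 / c + 1 + 1 / c) * X\<^sup>2 \<le> \<mu> / 2 * X\<^sup>2"
    using \<delta>G by (intro mult_right_mono) auto
  have e7: "\<delta>\<^sup>2 * (\<delta> * (B\<^sup>2 / c + B)) * Y\<^sup>2 \<le> \<delta>\<^sup>2 * (1 / 4) * Y\<^sup>2"
    using \<delta>H by (intro mult_right_mono mult_left_mono) auto
  have e8: "\<delta>\<^sup>2 * (r * (X + Y)) \<le> 1 * (r * (X + Y))" "\<delta> ^ 3 * (r * (Y + Z)) \<le> 1 * (r * (Y + Z))"
    using nn d2 d3 \<delta> by (intro mult_right_mono; simp)+
  have e9: "m * X\<^sup>2 \<le> \<mu> / 2 * X\<^sup>2" "m * Y\<^sup>2 \<le> \<delta>\<^sup>2 / 2 * Y\<^sup>2" "m * Z\<^sup>2 \<le> \<delta> ^ 3 * c / 4 * Z\<^sup>2"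
    using m by (intro mult_right_mono; simp)+
  have e10: "0 \<le> r * X" "0 \<le> r * Y" "0 \<le> r * Z" using nn by auto
  \<comment> \<open>Once the monomials are named, the remaining bookkeeping is linear in
    them.\<close>
  define D2Y D3Z where "D2Y = \<delta>\<^sup>2 * Y\<^sup>2" and "D3Z = \<delta> ^ 3 * (c / 4 * Z\<^sup>2)"
  define KX1 KX2 KX3 KX4 where "KX1 = \<delta> * (L + B)\<^sup>2 * X\<^sup>2" and "KX2 = \<delta> * (B\<^sup>2 / c) * X\<^sup>2"
    and "KX3 = \<delta> * X\<^sup>2" and "KX4 = \<delta> * (1 / c) * X\<^sup>2"
  define KY1 KY2 where "KY1 = \<delta>\<^sup>2 * (\<delta> * (B\<^sup>2 / c)) * Y\<^sup>2" and "KY2 = \<delta>\<^sup>2 * (\<delta> * B) * Y\<^sup>2"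
  note K_defs = D2Y_def D3Z_def KX1_def KX2_def KX3_def KX4_def KY1_def KY2_def
  have 1: "\<delta>\<^sup>2 * ((L + B) * X * Y - Y\<^sup>2 + r * Y + B * X * Z + X\<^sup>2 + r * X)
    \<le> KX1 + KX2 + KX3 - 3 / 4 * D2Y + D3Z + r * (X + Y)"
  proof -
    have "\<delta>\<^sup>2 * ((L + B) * X * Y - Y\<^sup>2 + r * Y + B * X * Z + X\<^sup>2 + r * X)
      = \<delta>\<^sup>2 * ((L + B) * X * Y) - D2Y + \<delta>\<^sup>2 * (B * X * Z) + \<delta>\<^sup>2 * X\<^sup>2 + \<delta>\<^sup>2 * (r * (X + Y))"
      by (simp add: K_defs algebra_simps)
    then show ?thesis using e1 e2 e5 e8(1) unfolding K_defs by linarith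
  qed
  have 2: "\<delta> ^ 3 * (B * Y * Z - c * Z\<^sup>2 + X * Z + r * Z + B * Y\<^sup>2 + r * Y)
    \<le> KX4 + KY1 + KY2 - 2 * D3Z + r * (Y + Z)"
  proof -
    have "\<delta> ^ 3 * (B * Y * Z - c * Z\<^sup>2 + X * Z + r * Z + B * Y\<^sup>2 + r * Y)
      = \<delta> ^ 3 * (B * Y * Z) - 4 * D3Z + \<delta> ^ 3 * (X * Z) + KY2 + \<delta> ^ 3 * (r * (Y + Z))"
      by (simp add: K_defs power2_eq_square power3_eq_cube algebra_simps)
    then show ?thesis using e3 e4 e8(2) unfolding K_defs by linarith
  qed
  have 3: "KX1 + KX2 + KX3 + KX4 \<le> \<mu> / 2 * X\<^sup>2"
    using e6 by (simp only: K_defs distrib_left distrib_right mult_1_right)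
  have 4: "KY1 + KY2 \<le> D2Y / 4"
    using e7 by (simp add: K_defs distrib_left distrib_right)
  have 5: "m * X\<^sup>2 \<le> \<mu> / 2 * X\<^sup>2" "m * Y\<^sup>2 \<le> D2Y / 2" "m * Z\<^sup>2 \<le> D3Z"
    using e9 by (simp_all add: K_defs)
  have "- \<mu> * X\<^sup>2 + r * (X + Y + Z) + (KX1 + KX2 + KX3 - 3 / 4 * D2Y + D3Z + r * (X + Y))
      + (KX4 + KY1 + KY2 - 2 * D3Z + r * (Y + Z)) \<le> - m * (X\<^sup>2 + Y\<^sup>2 + Z\<^sup>2) + 3 * r * (X + Y + Z)"
    using 3 4 5 e10 by (simp add: algebra_simps)
  then show ?thesis
    by (rule order_trans[OF add_mono[OF add_mono[OF order_refl 1] 2]])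
qed

text \<open>Derivative of the Lyapunov function along the flow, bounded by norms via Cauchy-Schwarz.
  Coercivity of \<open>T\<close> is asked only at \<open>z\<close>, because the Laplacian is
  coercive only on mean-free vectors.\<close>

lemma saddle_dissipation:
  fixes T :: "'a::real_inner \<Rightarrow> 'a" and x l z h q1 q2 q3 :: 'a
  assumes sa: "\<And>v w. v \<bullet> T w = T v \<bullet> w" and psd: "\<And>v. v \<bullet> T v \<ge> 0"
    and bd: "\<And>v. norm (T v) \<le> B * norm v" and coer: "z \<bullet> T z \<ge> c * (norm z)\<^sup>2"
    and mono: "x \<bullet> h \<ge> \<mu> * (norm x)\<^sup>2" and lip: "norm h \<le> L * norm x"
    and q: "norm q1 \<le> r" "norm q2 \<le> r" "norm q3 \<le> r" and ab: "\<alpha> \<ge> 0" "\<beta> \<ge> 0"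
  defines "x' \<equiv> - h - l + q1" and "l' \<equiv> - T l - T z + x + q2" and "z' \<equiv> T l + q3"
  shows "x \<bullet> x' + l \<bullet> l' + z \<bullet> z' + \<alpha> * (x \<bullet> l' + x' \<bullet> l) + \<beta> * (l \<bullet> z' + l' \<bullet> z)
    \<le> - \<mu> * (norm x)\<^sup>2 + r * (norm x + norm l + norm z)
      + \<alpha> * ((L + B) * norm x * norm l - (norm l)\<^sup>2 + r * norm l + B * norm x * norm z
          + (norm x)\<^sup>2 + r * norm x)
      + \<beta> * (B * norm l * norm z - c * (norm z)\<^sup>2 + norm x * norm z + r * norm z
          + B * (norm l)\<^sup>2 + r * norm l)"
proof -
  have qs: "v \<bullet> q1 \<le> r * norm v" "v \<bullet> q2 \<le> r * norm v" "v \<bullet> q3 \<le> r * norm v" for v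
    using q order_trans[OF norm_cauchy_schwarz mult_left_mono[OF _ norm_ge_zero]]
    by (metis mult.commute)+
  have Ts: "\<bar>v \<bullet> T w\<bar> \<le> B * norm v * norm w" for v w
  proof -
    have "\<bar>v \<bullet> T w\<bar> \<le> norm v * norm (T w)" by (rule Cauchy_Schwarz_ineq2)
    also have "\<dots> \<le> norm v * (B * norm w)" by (intro mult_left_mono bd) auto
    finally show ?thesis by (simp add: mult_ac)
  qed
  have hl: "\<bar>l \<bullet> h\<bar> \<le> L * norm x * norm l"
  proof -
    have "\<bar>l \<bullet> h\<bar> \<le> norm l * norm h" by (rule Cauchy_Schwarz_ineq2)
    also have "\<dots> \<le> norm l * (L * norm x)" by (intro mult_left_mono lip) auto
    finally show ?thesis by (simp add: mult_ac)
  qed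
  \<comment> \<open>The couplings of \<open>x\<close> with \<open>l\<close> and of \<open>l\<close>
    with \<open>z\<close> are skew and cancel, so the squared distance dissipates through
    \<open>h\<close> only.\<close>
  have A: "x \<bullet> x' + l \<bullet> l' + z \<bullet> z' \<le> - \<mu> * (norm x)\<^sup>2 + r * (norm x + norm l + norm z)"
    using mono psd[of l] qs[of x] qs[of l] qs[of z] sa[of z l] inner_commute[of "T z" l]
    by (simp add: x'_def l'_def z'_def inner_diff_right inner_add_right inner_commute[of l x] algebra_simps)
  \<comment> \<open>The term \<open>- l\<close> in \<open>x'\<close> makes the first cross term damp
    \<open>l\<close>.\<close>
  have Bd: "x \<bullet> l' + x' \<bullet> l \<le> (L + B) * norm x * norm l - (norm l)\<^sup>2 + r * norm l + B * norm x * norm z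
          + (norm x)\<^sup>2 + r * norm x"
    using Ts[of x l] Ts[of x z] hl qs[of l] qs[of x]
    by (simp add: x'_def l'_def inner_diff_right inner_add_right inner_diff_left inner_add_left
        inner_commute[of h l] inner_commute[of q1 l] power2_norm_eq_inner algebra_simps)
  \<comment> \<open>The term \<open>- T z\<close> in \<open>l'\<close> makes the second cross term
    damp \<open>z\<close>.\<close>
  have C: "l \<bullet> z' + l' \<bullet> z \<le> B * norm l * norm z - c * (norm z)\<^sup>2 + norm x * norm z + r * norm z
          + B * (norm l)\<^sup>2 + r * norm l"
    using Ts[of l l] Ts[of z l] coer qs[of l] qs[of z] norm_cauchy_schwarz[of x z]
    by (simp add: l'_def z'_def inner_diff_right inner_add_right inner_diff_left inner_add_left
        inner_commute[of "T l" z] inner_commute[of "T z" z] inner_commute[of q2 z]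
        power2_eq_square algebra_simps)
  show ?thesis using A mult_left_mono[OF Bd ab(1)] mult_left_mono[OF C ab(2)] by linarith
qed

text \<open>Input-to-state stability with linear gain. The gain depends on \<open>\<mu>\<close>,
  \<open>L\<close>, \<open>B\<close>, \<open>c\<close> alone, so one \<open>C\<close> serves every
  input level \<open>r\<close>; the start time \<open>t0\<close> is free because the input bound
  will hold only after the observer transient.\<close>

lemma saddle_flow_input_to_state:
  fixes \<mu> L B c :: real
  assumes pos: "\<mu> > 0" "L \<ge> 0" "B \<ge> 0" "c > 0"
  shows "\<exists>C>0. \<forall>(T :: 'a::real_inner \<Rightarrow> 'a) r t0 x l z h q1 q2 q3.
    (\<forall>v w. v \<bullet> T w = T v \<bullet> w) \<longrightarrow> (\<forall>v. v \<bullet> T v \<ge> 0) \<longrightarrow> (\<forall>v. norm (T v) \<le> B * norm v) \<longrightarrow> r > 0 \<longrightarrow>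
    (\<forall>t\<ge>t0. (x has_vector_derivative - h t - l t + q1 t) (at t within {t0..}) \<and>
       (l has_vector_derivative - T (l t) - T (z t) + x t + q2 t) (at t within {t0..}) \<and>
       (z has_vector_derivative T (l t) + q3 t) (at t within {t0..}) \<and>
       z t \<bullet> T (z t) \<ge> c * (norm (z t))\<^sup>2 \<and>
       x t \<bullet> h t \<ge> \<mu> * (norm (x t))\<^sup>2 \<and> norm (h t) \<le> L * norm (x t) \<and>
       norm (q1 t) \<le> r \<and> norm (q2 t) \<le> r \<and> norm (q3 t) \<le> r) \<longrightarrow>
    eventually (\<lambda>t. norm (x t) \<le> C * r) at_top"
proof -
  define G where "G = (L + B)\<^sup>2 + B\<^sup>2 / c + 1 + 1 / c"
  \<comment> \<open>The summand \<open>1\<close> keeps \<open>H\<close> positive even for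
    \<open>B = 0\<close>, so that dividing by it is safe.\<close>
  define H where "H = B\<^sup>2 / c + B + 1"
  have "(L + B)\<^sup>2 \<ge> 0" "B\<^sup>2 / c \<ge> 0" "1 / c > 0" using pos by auto
  then have GH: "G > 0" "H > 0" unfolding G_def H_def using pos by linarith+
  \<comment> \<open>The bound \<open>1 / 2\<close> keeps \<open>W\<close> between a quarter of
    \<open>S\<close> and \<open>S\<close>; the other two provide the smallness required by the
    scalar estimate.\<close>
  define \<delta> where "\<delta> = min (1 / 2) (min (\<mu> / (2 * G)) (1 / (4 * H)))"
  have \<delta>: "\<delta> > 0" "\<delta> \<le> 1 / 2" "\<delta> \<le> \<mu> / (2 * G)" "\<delta> \<le> 1 / (4 * H)"
    using pos GH unfolding \<delta>_def by auto
  have \<delta>G: "\<delta> * ((L + B)\<^sup>2 + B\<^sup>2 / c + 1 + 1 / c) \<le> \<mu> / 2"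
    using \<delta>(3) GH(1) unfolding G_def[symmetric] by (simp add: field_simps)
  have "\<delta> * H \<le> 1 / 4" using \<delta>(4) GH(2) by (simp add: field_simps)
  then have \<delta>H: "\<delta> * (B\<^sup>2 / c + B) \<le> 1 / 4" using \<delta>(1) by (simp add: H_def distrib_left)
  define m where "m = min (\<mu> / 2) (min (\<delta>\<^sup>2 / 2) (\<delta> ^ 3 * c / 4))"
  have m: "m > 0" "m \<le> \<mu> / 2" "m \<le> \<delta>\<^sup>2 / 2" "m \<le> \<delta> ^ 3 * c / 4"
    using pos \<delta>(1) unfolding m_def by auto
  have "\<delta>\<^sup>2 \<le> (1 / 2)\<^sup>2" "\<delta> ^ 3 \<le> (1 / 2) ^ 3" using \<delta> by (intro power_mono; simp)+
  then have small: "\<delta>\<^sup>2 \<le> 1 / 4" "\<delta> ^ 3 \<le> 1 / 4" by (simp_all add: power2_eq_square power3_eq_cube)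
  \<comment> \<open>The decay lemma ends with \<open>216 * (r / m)^2\<close> for the squared norm,
    and 225, the square of 15, rounds this up.\<close>
  have "eventually (\<lambda>t. norm (x t) \<le> (15 / m) * r) at_top"
    if sa: "\<And>v w. v \<bullet> T w = T v \<bullet> w" and psd: "\<And>v. v \<bullet> T v \<ge> 0"
      and bd: "\<And>v. norm (T v) \<le> B * norm v" and r: "r > 0"
      and sol: "\<forall>t\<ge>t0. (x has_vector_derivative - h t - l t + q1 t) (at t within {t0..}) \<and>
       (l has_vector_derivative - T (l t) - T (z t) + x t + q2 t) (at t within {t0..}) \<and>
       (z has_vector_derivative T (l t) + q3 t) (at t within {t0..}) \<and>
       z t \<bullet> T (z t) \<ge> c * (norm (z t))\<^sup>2 \<and>
       x t \<bullet> h t \<ge> \<mu> * (norm (x t))\<^sup>2 \<and> norm (h t) \<le> L * norm (x t) \<and>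
       norm (q1 t) \<le> r \<and> norm (q2 t) \<le> r \<and> norm (q3 t) \<le> r"
    for T :: "'a \<Rightarrow> 'a" and r t0 and x l z h q1 q2 q3 :: "real \<Rightarrow> 'a"
  proof -
    define S where "S t = (norm (x t))\<^sup>2 + (norm (l t))\<^sup>2 + (norm (z t))\<^sup>2" for t
    define W where "W t = (x t \<bullet> x t + l t \<bullet> l t + z t \<bullet> z t) / 2 + \<delta>\<^sup>2 * (x t \<bullet> l t) + \<delta> ^ 3 * (l t \<bullet> z t)" for t
    have cross: "\<bar>b * (u \<bullet> v)\<bar> \<le> ((norm u)\<^sup>2 + (norm v)\<^sup>2) / 8" if "0 \<le> b" "b \<le> 1 / 4" for b and u v :: 'a
    proof -
      have "\<bar>u \<bullet> v\<bar> \<le> norm u * norm v" by (rule Cauchy_Schwarz_ineq2)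
      also have "\<dots> \<le> ((norm u)\<^sup>2 + (norm v)\<^sup>2) / 2"
        using sum_squares_bound[of "norm u" "norm v"] by simp
      finally have "\<bar>u \<bullet> v\<bar> \<le> ((norm u)\<^sup>2 + (norm v)\<^sup>2) / 2" .
      then have "b * \<bar>u \<bullet> v\<bar> \<le> 1 / 4 * (((norm u)\<^sup>2 + (norm v)\<^sup>2) / 2)"
        using that by (intro mult_mono) auto
      then show ?thesis using that by (simp add: abs_mult)
    qed
    have half: "s \<le> 4 * (s / 2 + b + b')" "s / 2 + b + b' \<le> s"
      if "\<bar>b\<bar> \<le> (u + v) / 8" "\<bar>b'\<bar> \<le> (v + w) / 8" "s = u + v + w" "0 \<le> u" "0 \<le> v" "0 \<le> w"
      for s b b' u v w :: real
      using that by argo+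
    have WS: "S t \<le> 4 * W t" "W t \<le> S t" for t
      using half[OF cross[OF zero_le_power2 small(1)] cross[OF zero_le_power[OF less_imp_le[OF \<delta>(1)]] small(2)]
          _ zero_le_power2 zero_le_power2 zero_le_power2, of "S t"]
      by (simp_all add: S_def W_def power2_norm_eq_inner)
    have "eventually (\<lambda>t. W t \<le> 2 * (27 * r\<^sup>2 / (2 * m)) / (m / 2)) at_top"
    proof (rule eventually_le_of_linear_decay)
      show "m / 2 > 0" "27 * r\<^sup>2 / (2 * m) > 0" using m r by auto
      show "\<exists>D. (W has_real_derivative D) (at t within {t0..}) \<and> D \<le> 27 * r\<^sup>2 / (2 * m) - m / 2 * W t"
        if t: "t \<ge> t0" for t
      proof -
        define x' where "x' = - h t - l t + q1 t"
        define l' where "l' = - T (l t) - T (z t) + x t + q2 t"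
        define z' where "z' = T (l t) + q3 t"
        have der: "(x has_vector_derivative x') (at t within {t0..})"
          "(l has_vector_derivative l') (at t within {t0..})"
          "(z has_vector_derivative z') (at t within {t0..})"
          using sol t by (auto simp: x'_def l'_def z'_def)
        define D where "D = (x t \<bullet> x' + x' \<bullet> x t + (l t \<bullet> l' + l' \<bullet> l t) + (z t \<bullet> z' + z' \<bullet> z t)) / 2
          + \<delta>\<^sup>2 * (x t \<bullet> l' + x' \<bullet> l t) + \<delta> ^ 3 * (l t \<bullet> z' + l' \<bullet> z t)"
        have "(W has_real_derivative D) (at t within {t0..})"
          unfolding W_def D_def
          by (intro DERIV_add DERIV_cmult DERIV_cdivide has_real_derivative_inner der)
        moreover have "D \<le> 27 * r\<^sup>2 / (2 * m) - m / 2 * W t"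
        proof -
          have "D = x t \<bullet> x' + l t \<bullet> l' + z t \<bullet> z' + \<delta>\<^sup>2 * (x t \<bullet> l' + x' \<bullet> l t) + \<delta> ^ 3 * (l t \<bullet> z' + l' \<bullet> z t)"
            unfolding D_def by (simp add: inner_commute)
          also have "\<dots> \<le> - \<mu> * (norm (x t))\<^sup>2 + r * (norm (x t) + norm (l t) + norm (z t))
      + \<delta>\<^sup>2 * ((L + B) * norm (x t) * norm (l t) - (norm (l t))\<^sup>2 + r * norm (l t) + B * norm (x t) * norm (z t)
          + (norm (x t))\<^sup>2 + r * norm (x t))
      + \<delta> ^ 3 * (B * norm (l t) * norm (z t) - c * (norm (z t))\<^sup>2 + norm (x t) * norm (z t) + r * norm (z t)
          + B * (norm (l t))\<^sup>2 + r * norm (l t))"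
            unfolding x'_def l'_def z'_def
            by (rule saddle_dissipation[OF sa psd bd]) (use sol t \<delta> in auto)
          also have "\<dots> \<le> - m * S t + 3 * r * (norm (x t) + norm (l t) + norm (z t))"
            unfolding S_def
            by (rule saddle_dissipation_scalar) (use pos r \<delta> \<delta>G \<delta>H m in auto)
          also have "\<dots> \<le> - m * S t + (m / 2 * S t + 27 * r\<^sup>2 / (2 * m))"
          proof -
            \<comment> \<open>Used once per state: half of the damping \<open>m\<close> is spent,
              and three errors \<open>9 * r^2 / (2 * m)\<close> add up to the constant with
              27.\<close>
            have "3 * r * v \<le> m / 2 * v\<^sup>2 + 9 * r\<^sup>2 / (2 * m)" for v
              using mult_le_weighted_squares[of "2 * m" "3 * r" v] m
              by (simp add: power_mult_distrib)
            from this[of "norm (x t)"] this[of "norm (l t)"] this[of "norm (z t)"]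
            show ?thesis by (simp add: S_def distrib_left add_divide_distrib)
          qed
          also have "\<dots> = 27 * r\<^sup>2 / (2 * m) - m / 2 * S t" by simp
          also have "\<dots> \<le> 27 * r\<^sup>2 / (2 * m) - m / 2 * W t"
            using WS m by (intro diff_left_mono mult_left_mono) auto
          finally show ?thesis .
        qed
        ultimately show ?thesis by blast
      qed
    qed
    then show ?thesis
    proof eventually_elim
      case (elim t)
      have "(norm (x t))\<^sup>2 \<le> S t" by (simp add: S_def)
      also have "\<dots> \<le> 4 * (2 * (27 * r\<^sup>2 / (2 * m)) / (m / 2))" using WS[of t] elim by linarith
      also have "\<dots> = 216 * (r / m)\<^sup>2" using m by (simp add: field_simps power2_eq_square)
      also have "\<dots> \<le> 225 * (r / m)\<^sup>2" by (intro mult_right_mono) auto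
      also have "\<dots> = ((15 / m) * r)\<^sup>2" by (simp add: power2_eq_square)
      finally show ?case by (rule power2_le_imp_le) (use m r in auto)
    qed
  qed
  note decay = this
  show ?thesis
  proof (intro exI[of _ "15 / m"] conjI allI impI)
    show "15 / m > 0" using m(1) by simp
  qed (erule decay[rotated 4]; blast)
qed

section \<open>Gradients and optimality\<close>

text \<open>Justifies the definite description in \<open>grad\<close>.\<close>

lemma GDERIV_unique:
  fixes f :: "'a::real_inner \<Rightarrow> real"
  assumes "GDERIV f x :> D" "GDERIV f x :> E"
  shows "D = E"
proof -
  have "(\<lambda>h. h \<bullet> D) = (\<lambda>h. h \<bullet> E)"
    using assms unfolding gderiv_def by (rule has_derivative_unique)
  then have "(D - E) \<bullet> (D - E) = 0" by (metis inner_diff_right right_minus_eq)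
  then show ?thesis by simp
qed

text \<open>The derivative is a linear functional, and its Riesz representative has its values on
  the basis as coordinates.\<close>

lemma GDERIV_grad:
  fixes f :: "'a::euclidean_space \<Rightarrow> real"
  assumes "f differentiable (at x)"
  shows "GDERIV f x :> grad f x"
proof -
  obtain f' where f': "(f has_derivative f') (at x)" using assms by (auto simp: differentiable_def)
  have "f' h = h \<bullet> (\<Sum>b\<in>Basis. f' b *\<^sub>R b)" for h
  proof -
    have "f' h = f' (\<Sum>b\<in>Basis. (h \<bullet> b) *\<^sub>R b)" by (simp add: euclidean_representation)
    also have "\<dots> = (\<Sum>b\<in>Basis. (h \<bullet> b) * f' b)"
      using has_derivative_linear[OF f'] by (simp add: linear_sum linear_scale)
    finally show ?thesis by (simp add: inner_sum_right mult.commute)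
  qed
  then have "f' = (\<lambda>h. h \<bullet> (\<Sum>b\<in>Basis. f' b *\<^sub>R b))" by blast
  then have D: "GDERIV f x :> (\<Sum>b\<in>Basis. f' b *\<^sub>R b)"
    using f' unfolding gderiv_def by simp
  show ?thesis unfolding grad_def by (rule theI[of "\<lambda>D. GDERIV f x :> D", OF D]) (rule GDERIV_unique[OF _ D])
qed

lemma has_real_derivative_along_line:
  fixes f :: "'a::real_inner \<Rightarrow> real"
  assumes "GDERIV f x :> D"
  shows "((\<lambda>t. f (x + t *\<^sub>R v)) has_real_derivative v \<bullet> D) (at 0)"
proof -
  have "((\<lambda>t. x + t *\<^sub>R v) has_derivative (\<lambda>t. t *\<^sub>R v)) (at 0)"
    by (auto intro!: derivative_eq_intros)
  moreover have "(f has_derivative (\<lambda>h. h \<bullet> D)) (at (x + 0 *\<^sub>R v))"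
    using assms by (simp add: gderiv_def)
  ultimately have "((\<lambda>t. f (x + t *\<^sub>R v)) has_derivative (\<lambda>t. (t *\<^sub>R v) \<bullet> D)) (at 0)"
    by (rule has_derivative_compose)
  then show ?thesis by (simp add: has_field_derivative_def mult_commute_abs)
qed

text \<open>Letting \<open>t\<close> tend to 0 from the right in the convexity inequality gives the
  quadratic lower bound at a point. Adding it to itself with the points exchanged cancels the
  function values and keeps the same modulus.\<close>

lemma strongly_convex_grad_mono:
  fixes f :: "'a::euclidean_space \<Rightarrow> real"
  assumes diff: "\<And>x. f differentiable (at x)" and "strongly_convex f"
  shows "\<exists>\<mu>>0. \<forall>x y. \<mu> * (norm (x - y))\<^sup>2 \<le> (x - y) \<bullet> (grad f x - grad f y)"
proof -
  obtain \<mu> where \<mu>: "\<mu> > 0" and sc: "\<And>x y t. t \<in> {0..1} \<Longrightarrow> f (t *\<^sub>R x + (1 - t) *\<^sub>R y)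
       \<le> t * f x + (1 - t) * f y - \<mu> / 2 * t * (1 - t) * (norm (x - y))\<^sup>2"
    using assms(2) unfolding strongly_convex_def by blast
  have below: "(x - y) \<bullet> grad f y \<le> f x - f y - \<mu> / 2 * (norm (x - y))\<^sup>2" for x y
  proof -
    define N where "N = (norm (x - y))\<^sup>2"
    have "((\<lambda>t. f (y + t *\<^sub>R (x - y))) has_real_derivative (x - y) \<bullet> grad f y) (at 0)"
      by (intro has_real_derivative_along_line GDERIV_grad diff)
    then have "((\<lambda>t. (f (y + t *\<^sub>R (x - y)) - f y) / t) \<longlongrightarrow> (x - y) \<bullet> grad f y) (at_right 0)"
      by (auto simp: has_field_derivative_iff intro: tendsto_within_subset)
    moreover have "((\<lambda>t::real. f x - f y - \<mu> / 2 * (1 - t) * N) \<longlongrightarrow> f x - f y - \<mu> / 2 * (1 - 0) * N) (at_right 0)"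
      by (intro tendsto_intros)
    \<comment> \<open>The strong convexity inequality divided by \<open>t > 0\<close>, so that the
      limit of the difference quotients inherits it.\<close>
    moreover have "eventually (\<lambda>t. (f (y + t *\<^sub>R (x - y)) - f y) / t \<le> f x - f y - \<mu> / 2 * (1 - t) * N) (at_right 0)"
    proof -
      have "eventually (\<lambda>t::real. t \<in> {0<..<1}) (at_right 0)"
        by (intro eventually_at_right_real) simp
      then show ?thesis
      proof eventually_elim
        case (elim t)
        have "f (y + t *\<^sub>R (x - y)) = f (t *\<^sub>R x + (1 - t) *\<^sub>R y)" by (simp add: algebra_simps)
        also have "\<dots> \<le> t * f x + (1 - t) * f y - \<mu> / 2 * t * (1 - t) * N"
          using sc[of t x y] elim by (simp add: N_def)
        finally have "f (y + t *\<^sub>R (x - y)) - f y \<le> (f x - f y - \<mu> / 2 * (1 - t) * N) * t"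
          by (simp add: algebra_simps)
        then show ?case using elim by (simp add: pos_divide_le_eq)
      qed
    qed
    ultimately have "(x - y) \<bullet> grad f y \<le> f x - f y - \<mu> / 2 * (1 - 0) * N"
      by (intro tendsto_le[of "at_right (0::real)"]) (auto simp: trivial_limit_at_right_real)
    then show ?thesis by (simp add: N_def)
  qed
  have "\<mu> * (norm (x - y))\<^sup>2 \<le> (x - y) \<bullet> (grad f x - grad f y)" for x y
    using below[of x y] below[of y x]
    by (simp add: norm_minus_commute[of y x] inner_diff_left inner_diff_right)
  then show ?thesis using \<mu> by blast
qed

text \<open>Shifting resource between two agents stays feasible, so the cost is stationary under
  such shifts. Shifting along the difference of the two gradients makes the directional derivative
  its squared norm.\<close>

lemma optimal_allocation_grad_eq:
  fixes f :: "'m::finite \<Rightarrow> real ^ 'n \<Rightarrow> real"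
  assumes diff: "\<And>i x. f i differentiable (at x)" and opt: "optimal_allocation f d X"
  shows "grad (f i) (X $ i) = grad (f j) (X $ j)"
proof (cases "i = j")
  case False
  define G where "G k = grad (f k) (X $ k)" for k
  define v :: "real ^ 'n ^ 'm" where
    "v = (\<chi> k. if k = i then G i - G j else if k = j then - (G i - G j) else 0)"
  have split: "(\<Sum>k\<in>UNIV. u k) = u i + u j" if "\<And>k. k \<noteq> i \<Longrightarrow> k \<noteq> j \<Longrightarrow> u k = 0" for u :: "'m \<Rightarrow> 'b::comm_monoid_add"
  proof -
    have "(\<Sum>k\<in>UNIV. u k) = (\<Sum>k\<in>{i, j}. u k)"
      by (rule sum.mono_neutral_right) (use that in auto)
    then show ?thesis using False by simp
  qed
  have feasible: "(\<Sum>k\<in>UNIV. (X + t *\<^sub>R v) $ k) = (\<Sum>k\<in>UNIV. d $ k)" for t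
  proof -
    have "(\<Sum>k\<in>UNIV. v $ k) = 0" by (subst split) (use False in \<open>auto simp: v_def\<close>)
    then show ?thesis
      using opt by (simp add: optimal_allocation_def is_arg_min_def sum.distrib flip: scaleR_right.sum)
  qed
  define \<phi> where "\<phi> t = (\<Sum>k\<in>UNIV. f k (X $ k + t *\<^sub>R v $ k))" for t
  have "\<phi> 0 \<le> \<phi> t" for t
  proof -
    have "(\<Sum>k\<in>UNIV. f k (X $ k)) \<le> (\<Sum>k\<in>UNIV. f k (Y $ k))"
      if "(\<Sum>k\<in>UNIV. Y $ k) = (\<Sum>k\<in>UNIV. d $ k)" for Y
    proof -
      have "\<not> (\<Sum>k\<in>UNIV. f k (Y $ k)) < (\<Sum>k\<in>UNIV. f k (X $ k))"
        using opt that unfolding optimal_allocation_def is_arg_min_def by blast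
      then show ?thesis by simp
    qed
    from this[OF feasible[of t]] show ?thesis by (simp add: \<phi>_def)
  qed
  moreover have "(\<phi> has_real_derivative (\<Sum>k\<in>UNIV. v $ k \<bullet> G k)) (at 0)"
    unfolding \<phi>_def G_def by (intro DERIV_sum has_real_derivative_along_line GDERIV_grad diff)
  ultimately have "(\<Sum>k\<in>UNIV. v $ k \<bullet> G k) = 0"
    by (intro DERIV_local_min[of \<phi> _ 0 1]) auto
  moreover have "(\<Sum>k\<in>UNIV. v $ k \<bullet> G k) = v $ i \<bullet> G i + v $ j \<bullet> G j"
    by (rule split) (simp add: v_def)
  moreover have "\<dots> = (G i - G j) \<bullet> (G i - G j)"
    using False by (simp add: v_def inner_diff_left inner_diff_right)
  ultimately show ?thesis by (simp add: G_def)
qed simp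

section \<open>The graph Laplacian on stacked vectors\<close>

definition laplacian :: "('m::finite \<Rightarrow> 'm \<Rightarrow> real) \<Rightarrow> real ^ 'n ^ 'm \<Rightarrow> real ^ 'n ^ 'm" where
  "laplacian a v = (\<chi> i. disagreement a v i)"

lemma laplacian_nth [simp]: "laplacian a v $ i = disagreement a v i"
  by (simp add: laplacian_def)

lemma bounded_linear_laplacian: "bounded_linear (laplacian a)"
  unfolding linear_conv_bounded_linear[symmetric]
  by (rule linearI)
    (simp_all add: vec_eq_iff disagreement_def algebra_simps sum.distrib sum_subtractf scaleR_sum_right)

lemma laplacian_const [simp]: "laplacian a (\<chi> i. c) = 0"
  by (simp add: vec_eq_iff disagreement_def)

context
  fixes a :: "'m::finite \<Rightarrow> 'm \<Rightarrow> real"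
  assumes weights: "connected_undirected_weights a"
begin

lemma weights_sym: "a i j = a j i" and weights_nonneg: "0 \<le> a i j"
  using weights by (auto simp: connected_undirected_weights_def)

text \<open>The edge form of the Laplacian, obtained by averaging the sum with its copy under
  exchange of the two indices. Symmetry, nonnegativity and the kernel can all be read off from
  it.\<close>

lemma inner_laplacian:
  fixes v w :: "real ^ 'n ^ 'm"
  shows "2 * (v \<bullet> laplacian a w) = (\<Sum>i\<in>UNIV. \<Sum>j\<in>UNIV. a i j * ((v $ i - v $ j) \<bullet> (w $ i - w $ j)))"
proof -
  have 1: "v \<bullet> laplacian a w = (\<Sum>i\<in>UNIV. \<Sum>j\<in>UNIV. a i j * (v $ i \<bullet> (w $ i - w $ j)))"
    by (subst inner_vec_def) (simp add: disagreement_def inner_sum_right)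
  also have "\<dots> = (\<Sum>j\<in>UNIV. \<Sum>i\<in>UNIV. a i j * (v $ i \<bullet> (w $ i - w $ j)))" by (rule sum.swap)
  also have "\<dots> = - (\<Sum>i\<in>UNIV. \<Sum>j\<in>UNIV. a i j * (v $ j \<bullet> (w $ i - w $ j)))"
  proof -
    have "a i j * (v $ i \<bullet> (w $ i - w $ j)) = - (a j i * (v $ i \<bullet> (w $ j - w $ i)))" for i j
      by (simp add: weights_sym[of j i] inner_diff_right right_diff_distrib)
    then show ?thesis unfolding sum_negf[symmetric] by (intro sum.cong refl)
  qed
  finally have 2: "v \<bullet> laplacian a w = \<dots>" .
  have "2 * (v \<bullet> laplacian a w) = v \<bullet> laplacian a w + v \<bullet> laplacian a w" by simp
  also have "\<dots> = (\<Sum>i\<in>UNIV. \<Sum>j\<in>UNIV. a i j * (v $ i \<bullet> (w $ i - w $ j)))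
      - (\<Sum>i\<in>UNIV. \<Sum>j\<in>UNIV. a i j * (v $ j \<bullet> (w $ i - w $ j)))"
    using 1 2 by linarith
  finally show ?thesis by (simp add: inner_diff_left right_diff_distrib sum_subtractf)
qed

lemma laplacian_self_adjoint: "v \<bullet> laplacian a w = laplacian a v \<bullet> (w :: real ^ 'n ^ 'm)"
proof -
  have "2 * (v \<bullet> laplacian a w) = 2 * (w \<bullet> laplacian a v)"
    unfolding inner_laplacian by (simp add: inner_commute)
  then show ?thesis by (simp add: inner_commute)
qed

lemma laplacian_nonneg: "0 \<le> v \<bullet> laplacian a (v :: real ^ 'n ^ 'm)"
proof -
  have "0 \<le> 2 * (v \<bullet> laplacian a v)"
    unfolding inner_laplacian by (intro sum_nonneg mult_nonneg_nonneg weights_nonneg) auto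
  then show ?thesis by simp
qed

text \<open>A vanishing sum of nonnegative edge terms forces agreement across every edge, and
  connectedness carries it along paths.\<close>

lemma laplacian_zero_imp_consensus:
  fixes v :: "real ^ 'n ^ 'm"
  assumes "v \<bullet> laplacian a v = 0"
  shows "v $ i = v $ j"
proof -
  have "(\<Sum>i\<in>UNIV. \<Sum>j\<in>UNIV. a i j * ((v $ i - v $ j) \<bullet> (v $ i - v $ j))) = 0"
    using inner_laplacian[of v v] assms by simp
  then have 0: "a i j * ((v $ i - v $ j) \<bullet> (v $ i - v $ j)) = 0" for i j
    by (simp add: sum_nonneg_eq_0_iff sum_nonneg weights_nonneg)
  have "(i, j) \<in> {(k, l). 0 < a k l}\<^sup>*"
    using weights by (simp add: connected_undirected_weights_def)
  then show ?thesis
  proof induction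
    case (step k l)
    then show ?case using 0[of k l] by simp
  qed simp
qed

text \<open>The summand is antisymmetric in the two indices, so the sum equals its own
  negative.\<close>

lemma sum_disagreement [simp]: "(\<Sum>i\<in>UNIV. disagreement a (v :: real ^ 'n ^ 'm) i) = 0"
proof -
  have "(\<Sum>i\<in>UNIV. disagreement a v i) = (\<Sum>i\<in>UNIV. \<Sum>j\<in>UNIV. a i j *\<^sub>R (v $ i - v $ j))"
    by (simp add: disagreement_def)
  also have "\<dots> = (\<Sum>j\<in>UNIV. \<Sum>i\<in>UNIV. a i j *\<^sub>R (v $ i - v $ j))" by (rule sum.swap)
  also have "\<dots> = - (\<Sum>i\<in>UNIV. \<Sum>j\<in>UNIV. a i j *\<^sub>R (v $ i - v $ j))"
  proof -
    have "a i j *\<^sub>R (v $ i - v $ j) = - (a j i *\<^sub>R (v $ j - v $ i))" for i j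
      by (simp add: weights_sym[of j i] scaleR_diff_right)
    then show ?thesis unfolding sum_negf[symmetric] by (intro sum.cong refl)
  qed
  also have "(\<Sum>i\<in>UNIV. \<Sum>j\<in>UNIV. a i j *\<^sub>R (v $ i - v $ j)) = (\<Sum>i\<in>UNIV. disagreement a v i)"
    by (simp add: disagreement_def)
  finally have "2 *\<^sub>R (\<Sum>i\<in>UNIV. disagreement a v i) = 0" by (simp add: scaleR_2)
  then show ?thesis by simp
qed

text \<open>The added term removes the consensus kernel and vanishes on mean-free vectors. One
  compactness argument thus yields coercivity, and injectivity yields solvability, without
  spectral theory.\<close>

definition augmented_laplacian :: "real ^ 'n ^ 'm \<Rightarrow> real ^ 'n ^ 'm" where
  "augmented_laplacian v = laplacian a v + (\<chi> i. \<Sum>j\<in>UNIV. v $ j)"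

lemma inner_augmented_laplacian:
  "v \<bullet> augmented_laplacian v = v \<bullet> laplacian a v + (norm (\<Sum>j\<in>UNIV. v $ j))\<^sup>2"
proof -
  have "v \<bullet> (\<chi> i. \<Sum>j\<in>UNIV. v $ j) = (norm (\<Sum>j\<in>UNIV. v $ j))\<^sup>2"
    by (subst inner_vec_def) (simp add: power2_norm_eq_inner flip: inner_sum_left)
  then show ?thesis by (simp add: augmented_laplacian_def inner_add_right)
qed

lemma linear_augmented_laplacian: "linear (augmented_laplacian :: real ^ 'n ^ 'm \<Rightarrow> _)"
proof (rule linearI)
  interpret bounded_linear "laplacian a :: real ^ 'n ^ 'm \<Rightarrow> _" by (rule bounded_linear_laplacian)
  show "augmented_laplacian (v + w) = augmented_laplacian v + augmented_laplacian (w :: real ^ 'n ^ 'm)" for v w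
    by (simp add: augmented_laplacian_def add vec_eq_iff sum.distrib)
  show "augmented_laplacian (r *\<^sub>R v) = r *\<^sub>R augmented_laplacian (v :: real ^ 'n ^ 'm)" for r v
    by (simp add: augmented_laplacian_def scaleR vec_eq_iff scaleR_sum_right scaleR_add_right)
qed

lemma augmented_laplacian_pos:
  fixes v :: "real ^ 'n ^ 'm"
  assumes "v \<noteq> 0"
  shows "0 < v \<bullet> augmented_laplacian v"
proof (rule ccontr)
  assume "\<not> ?thesis"
  then have "v \<bullet> laplacian a v = 0" "(norm (\<Sum>j\<in>UNIV. v $ j))\<^sup>2 = 0"
    using laplacian_nonneg[of v] zero_le_power2[of "norm (\<Sum>j\<in>UNIV. v $ j)"]
    unfolding inner_augmented_laplacian by linarith+
  \<comment> \<open>The first equation forces consensus, the second a zero sum; together they leave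
    only the zero vector.\<close>
  then have 0: "v \<bullet> laplacian a v = 0" "(\<Sum>j\<in>UNIV. v $ j) = 0" by simp_all
  have "v $ i = 0" for i
  proof -
    have "(\<Sum>j\<in>UNIV. v $ j) = (\<Sum>j\<in>(UNIV :: 'm set). v $ i)"
      by (intro sum.cong refl laplacian_zero_imp_consensus[OF 0(1)])
    then show ?thesis using 0(2) by (simp add: sum_constant_scaleR del: sum_constant)
  qed
  then show False using assms by (simp add: vec_eq_iff)
qed

lemma laplacian_coercive:
  "\<exists>c>0. \<forall>v :: real ^ 'n ^ 'm. (\<Sum>j\<in>UNIV. v $ j) = 0 \<longrightarrow> c * (norm v)\<^sup>2 \<le> v \<bullet> laplacian a v"
proof -
  let ?S = "sphere (0 :: real ^ 'n ^ 'm) 1"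
  have "continuous_on ?S (\<lambda>v. v \<bullet> augmented_laplacian v)"
    by (intro continuous_intros linear_continuous_on)
      (simp add: linear_augmented_laplacian flip: linear_conv_bounded_linear)
  moreover have "?S \<noteq> {}" by simp
  \<comment> \<open>The minimum over the unit sphere is the coercivity constant; quadratic scaling
    extends it to all vectors.\<close>
  ultimately obtain u where u: "u \<in> ?S" "\<And>v. v \<in> ?S \<Longrightarrow> u \<bullet> augmented_laplacian u \<le> v \<bullet> augmented_laplacian v"
    using continuous_attains_inf[OF compact_sphere, of "0 :: real ^ 'n ^ 'm" 1] by blast
  have pos: "0 < u \<bullet> augmented_laplacian u" using u(1) by (intro augmented_laplacian_pos) auto
  have "u \<bullet> augmented_laplacian u * (norm v)\<^sup>2 \<le> v \<bullet> laplacian a v" if "(\<Sum>j\<in>UNIV. v $ j) = 0" for v :: "real ^ 'n ^ 'm"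
  proof (cases "v = 0")
    case False
    have "u \<bullet> augmented_laplacian u \<le> (v /\<^sub>R norm v) \<bullet> augmented_laplacian (v /\<^sub>R norm v)"
      using False by (intro u(2)) simp
    also have "\<dots> = (v \<bullet> augmented_laplacian v) / (norm v)\<^sup>2"
      by (simp add: linear_scale[OF linear_augmented_laplacian] power2_eq_square divide_inverse)
    also have "v \<bullet> augmented_laplacian v = v \<bullet> laplacian a v"
      using that by (simp add: inner_augmented_laplacian)
    finally show ?thesis using False by (simp add: pos_le_divide_eq)
  qed simp
  then show ?thesis using pos by blast
qed

lemma laplacian_solvable:
  fixes b :: "real ^ 'n ^ 'm"
  assumes "(\<Sum>i\<in>UNIV. b $ i) = 0"
  obtains z where "laplacian a z = b"
proof -
  have "inj (augmented_laplacian :: real ^ 'n ^ 'm \<Rightarrow> _)"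
    unfolding linear_injective_0[OF linear_augmented_laplacian]
    using augmented_laplacian_pos by fastforce
  then have "surj (augmented_laplacian :: real ^ 'n ^ 'm \<Rightarrow> _)"
    using linear_augmented_laplacian by (intro linear_injective_imp_surjective) auto
  then obtain z where z: "augmented_laplacian z = b" by (metis surjD)
  \<comment> \<open>Summing the blocks removes the Laplacian part. A right-hand side of zero sum
    thus has a preimage of zero sum, on which the added term vanishes.\<close>
  have "(\<Sum>i\<in>UNIV. augmented_laplacian z $ i) = of_nat CARD('m) *\<^sub>R (\<Sum>j\<in>UNIV. z $ j)"
    by (simp add: augmented_laplacian_def sum.distrib sum_constant_scaleR del: sum_constant)
  then have "(\<Sum>j\<in>UNIV. z $ j) = 0" using z assms by simp
  then have "laplacian a z = b" using z by (simp add: augmented_laplacian_def vec_eq_iff)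
  then show ?thesis by (rule that)
qed

end

section \<open>The orthogonal projection onto stacked vectors of zero sum\<close>

definition mean_free :: "real ^ 'n ^ 'm::finite \<Rightarrow> real ^ 'n ^ 'm" where
  "mean_free v = v - (\<chi> i. (\<Sum>j\<in>UNIV. v $ j) /\<^sub>R CARD('m))"

lemma bounded_linear_mean_free: "bounded_linear mean_free"
  unfolding linear_conv_bounded_linear[symmetric]
  by (rule linearI)
    (simp_all add: mean_free_def vec_eq_iff algebra_simps sum.distrib flip: scaleR_sum_right)

lemma sum_mean_free: "(\<Sum>i\<in>UNIV. mean_free v $ i) = 0"
  by (simp add: mean_free_def sum_subtractf sum_constant_scaleR del: sum_constant)

lemma laplacian_mean_free [simp]: "laplacian a (mean_free v) = laplacian a v"
  unfolding mean_free_def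
  by (simp add: bounded_linear.linear[OF bounded_linear_laplacian, THEN linear_diff])

section \<open>The closed loop\<close>

text \<open>Disagreements mix the agents, so the agentwise derivatives are collected into one
  stacked derivative with a common bound.\<close>

lemma bounded_with_bounded_derivative_stack:
  fixes s :: "real \<Rightarrow> 'a::real_normed_vector ^ 'm::finite"
  assumes "\<And>i. bounded_with_bounded_derivative (\<lambda>t. s t $ i)"
  obtains s' K where "\<And>t. t \<ge> 0 \<Longrightarrow> (s has_vector_derivative s' t) (at t within {0..})"
    and "K \<ge> 0" "\<And>t. t \<ge> 0 \<Longrightarrow> norm (s' t) \<le> K"
proof -
  have "\<exists>D. (\<forall>t\<ge>0. ((\<lambda>t. s t $ i) has_vector_derivative D t) (at t within {0..})) \<and> bounded (D ` {0..})" for i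
    using assms[of i] by (simp add: bounded_with_bounded_derivative_def)
  then obtain D where D: "\<And>i t. t \<ge> 0 \<Longrightarrow> ((\<lambda>t. s t $ i) has_vector_derivative D i t) (at t within {0..})"
    and "\<And>i. bounded (D i ` {0..})" by metis
  then have "\<exists>b. \<forall>t\<ge>0. norm (D i t) \<le> b" for i
    unfolding bounded_iff by (metis atLeast_iff imageI)
  then obtain b where b: "\<And>i t. t \<ge> 0 \<Longrightarrow> norm (D i t) \<le> b i" by metis
  show ?thesis
  proof (rule that)
    show "(s has_vector_derivative (\<chi> i. D i t)) (at t within {0..})" if "t \<ge> 0" for t
      using D[OF that] by (intro has_vector_derivative_vec) simp
    have "norm (\<chi> i. D i t) \<le> (\<Sum>i\<in>UNIV. b i)" if "t \<ge> 0" for t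
    proof -
      have "norm (\<chi> i. D i t) \<le> (\<Sum>i\<in>UNIV. norm (D i t))"
        unfolding norm_vec_def using L2_set_le_sum[of UNIV "\<lambda>i. norm (D i t)"] by simp
      also have "\<dots> \<le> (\<Sum>i\<in>UNIV. b i)" by (intro sum_mono b that)
      finally show ?thesis .
    qed
    then show "norm (\<chi> i. D i t) \<le> \<bar>\<Sum>i\<in>UNIV. b i\<bar>" if "t \<ge> 0" for t
      using that by (meson abs_ge_self order_trans)
    show "\<bar>\<Sum>i\<in>UNIV. b i\<bar> \<ge> 0" by simp
  qed
qed

lemma norm_stack_le:
  fixes v :: "'a::real_normed_vector ^ 'm::finite"
  assumes "\<And>i. norm (v $ i) \<le> b"
  shows "norm v \<le> of_nat CARD('m) * b"
proof -
  have "norm v \<le> (\<Sum>i\<in>UNIV. norm (v $ i))"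
    unfolding norm_vec_def by (rule L2_set_le_sum) simp
  also have "\<dots> \<le> (\<Sum>i\<in>(UNIV :: 'm set). b)" by (intro sum_mono assms)
  finally show ?thesis by simp
qed

text \<open>The signal \<open>q_i\<close>, the only input left in the plant: substituting it, the
  drift \<open>g\<close>, the attacks and the estimates all disappear from the three state
  equations.\<close>

definition estimation_error ::
  "('m \<Rightarrow> 'm \<Rightarrow> real) \<Rightarrow> ('m \<Rightarrow> real ^ 'n \<Rightarrow> real ^ 'n)
    \<Rightarrow> (real \<Rightarrow> real ^ 'n ^ 'm) \<Rightarrow> (real \<Rightarrow> real ^ 'n ^ 'm) \<Rightarrow> (real \<Rightarrow> real ^ 'n ^ 'm)
    \<Rightarrow> (real \<Rightarrow> real ^ 'n ^ 'm) \<Rightarrow> (real \<Rightarrow> 'n triple ^ 'm) \<Rightarrow> 'm \<Rightarrow> real \<Rightarrow> 'n triple" where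
  "estimation_error a g ua la za x kh i t =
     (kappa1 (ua t) i + g i (x t $ i), kappa2 a (la t) (za t) i, kappa3 a (la t) i) - kh t $ i"

text \<open>Plant and observer receive the same \<open>observer_input\<close>, so it cancels in the
  state error and the abstract observer estimate applies agent by agent. The constant may depend on
  \<open>M\<close> and the attacks but precedes \<open>w\<close> and the solution.\<close>

lemma estimation_error_bound:
  fixes a :: "'m::finite \<Rightarrow> 'm \<Rightarrow> real" and f :: "'m \<Rightarrow> real ^ 'n \<Rightarrow> real"
    and ua la za :: "real \<Rightarrow> real ^ 'n ^ 'm"
  assumes attacks: "\<And>i. bounded_with_bounded_derivative (\<lambda>t. ua t $ i)"
      "\<And>i. bounded_with_bounded_derivative (\<lambda>t. la t $ i)"
      "\<And>i. bounded_with_bounded_derivative (\<lambda>t. za t $ i)"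
    and pos: "a1 > 0" "a2 > 0"
  shows "\<exists>C>0. \<forall>w>0. \<forall>x l z gh kh.
    resilient_allocation_solution f d a g ua la za a1 a2
        (\<lambda>e. w *\<^sub>R e) (\<lambda>e. w\<^sup>2 *\<^sub>R e) x l z gh kh \<longrightarrow>
    drift_rate_bounded g x M \<longrightarrow>
    eventually (\<lambda>t. \<forall>i. norm (estimation_error a g ua la za x kh i t) \<le> C / w) at_top"
proof -
  obtain ua' Ku where ua': "\<And>t. t \<ge> 0 \<Longrightarrow> (ua has_vector_derivative ua' t) (at t within {0..})"
      "Ku \<ge> 0" "\<And>t. t \<ge> 0 \<Longrightarrow> norm (ua' t) \<le> Ku"
    using bounded_with_bounded_derivative_stack[OF attacks(1)] by blast
  obtain la' Kl where la': "\<And>t. t \<ge> 0 \<Longrightarrow> (la has_vector_derivative la' t) (at t within {0..})"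
      "Kl \<ge> 0" "\<And>t. t \<ge> 0 \<Longrightarrow> norm (la' t) \<le> Kl"
    using bounded_with_bounded_derivative_stack[OF attacks(2)] by blast
  obtain za' Kz where za': "\<And>t. t \<ge> 0 \<Longrightarrow> (za has_vector_derivative za' t) (at t within {0..})"
      "Kz \<ge> 0" "\<And>t. t \<ge> 0 \<Longrightarrow> norm (za' t) \<le> Kz"
    using bounded_with_bounded_derivative_stack[OF attacks(3)] by blast
  obtain B where B: "B > 0" "\<And>v :: real ^ 'n ^ 'm. norm (laplacian a v) \<le> norm v * B"
    using bounded_linear.pos_bounded[OF bounded_linear_laplacian] by blast
  have dis_bound: "norm (disagreement a v i) \<le> k * B" if "norm v \<le> k" for v :: "real ^ 'n ^ 'm" and i k
    using Finite_Cartesian_Product.norm_nth_le[of "laplacian a v" i] B(2)[of v] mult_right_mono[OF that, of B] B(1)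
    unfolding laplacian_nth by linarith
  have dis_der: "((\<lambda>t. disagreement a (s t) i) has_vector_derivative disagreement a D i) (at t within S)"
    if "(s has_vector_derivative D) (at t within S)" for s :: "real \<Rightarrow> real ^ 'n ^ 'm" and D i t S
    using bounded_linear.has_vector_derivative[OF bounded_linear_compose[OF bounded_linear_vec_nth[of i]
        bounded_linear_laplacian[of a]] that] by simp
  \<comment> \<open>A bound for the derivative of \<open>kappa_i\<close>, block by block. The
    absolute value covers any sign of \<open>M\<close>, and the final \<open>1\<close> makes
    \<open>K\<close> positive.\<close>
  define K where "K = (Ku + \<bar>M\<bar>) + ((Kl * B + Kz * B) + Kl * B) + 1"
  have "K > 0" using ua'(2) la'(2) za'(2) B(1) by (auto simp: K_def intro!: add_nonneg_pos)
  from extended_state_observer_error[OF pos this, where 'a = "'n triple"]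
  obtain C where C: "C > 0" and obs: "\<forall>w>0. \<forall>e q r :: real \<Rightarrow> 'n triple.
      (\<forall>t\<ge>0. (e has_vector_derivative q t - (a1 * w) *\<^sub>R e t) (at t within {0..})) \<longrightarrow>
      (\<forall>t\<ge>0. (q has_vector_derivative r t - (a2 * w\<^sup>2) *\<^sub>R e t) (at t within {0..})) \<longrightarrow>
      (\<forall>t\<ge>0. norm (r t) \<le> K) \<longrightarrow>
      eventually (\<lambda>t. norm (q t) \<le> C / w) at_top"
    by (elim exE conjE) (rule that)
  have "eventually (\<lambda>t. \<forall>i. norm (estimation_error a g ua la za x kh i t) \<le> C / w) at_top"
    if w: "w > 0"
      and sol: "resilient_allocation_solution f d a g ua la za a1 a2
        (\<lambda>e. w *\<^sub>R e) (\<lambda>e. w\<^sup>2 *\<^sub>R e) x l z gh kh"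
      and drift: "drift_rate_bounded g x M"
    for w x l z gh kh
  proof (rule eventually_all_finite)
    fix i
    define q where "q = estimation_error a g ua la za x kh i"
    define e where "e t = (x t $ i, l t $ i, z t $ i) - gh t $ i" for t
    obtain g' where g': "\<And>t. t \<ge> 0 \<Longrightarrow> ((\<lambda>s. g i (x s $ i)) has_vector_derivative g' t) (at t within {0..})"
        "\<And>t. t \<ge> 0 \<Longrightarrow> norm (g' t) \<le> M"
      using drift unfolding drift_rate_bounded_def by metis
    \<comment> \<open>The derivative of \<open>kappa_i\<close>, which forces the error
      system.\<close>
    define r where "r t = (ua' t $ i + g' t, - disagreement a (la' t) i - disagreement a (za' t) i,
      disagreement a (la' t) i)" for t
    note sol_i = sol[unfolded resilient_allocation_solution_def, rule_format, of _ i]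
    have "\<forall>t\<ge>0. (e has_vector_derivative q t - (a1 * w) *\<^sub>R e t) (at t within {0..})"
    proof (intro allI impI)
      fix t :: real assume t: "t \<ge> 0"
      have "(e has_vector_derivative (g i (x t $ i) - grad (f i) (x t $ i) - l t $ i
             + kappa1 (ua t) i - fst (kh t $ i),
           - disagreement a (l t) i - disagreement a (z t) i + x t $ i - d $ i
             + kappa2 a (la t) (za t) i - fst (snd (kh t $ i)),
           disagreement a (l t) i + kappa3 a (la t) i - snd (snd (kh t $ i)))
         - (kh t $ i + observer_input f d a (x t) (l t) (z t) (kh t $ i) i
             + a1 *\<^sub>R w *\<^sub>R ((x t $ i, l t $ i, z t $ i) - gh t $ i))) (at t within {0..})"
        unfolding e_def using sol_i[OF t]
        by (intro has_vector_derivative_diff has_vector_derivative_Pair) auto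
      also have "(g i (x t $ i) - grad (f i) (x t $ i) - l t $ i
             + kappa1 (ua t) i - fst (kh t $ i),
           - disagreement a (l t) i - disagreement a (z t) i + x t $ i - d $ i
             + kappa2 a (la t) (za t) i - fst (snd (kh t $ i)),
           disagreement a (l t) i + kappa3 a (la t) i - snd (snd (kh t $ i)))
         - (kh t $ i + observer_input f d a (x t) (l t) (z t) (kh t $ i) i
             + a1 *\<^sub>R w *\<^sub>R ((x t $ i, l t $ i, z t $ i) - gh t $ i)) = q t - (a1 * w) *\<^sub>R e t"
        unfolding q_def estimation_error_def e_def observer_input_def prod_eq_iff
        by simp
      finally show "(e has_vector_derivative q t - (a1 * w) *\<^sub>R e t) (at t within {0..})" .
    qed
    moreover have "\<forall>t\<ge>0. (q has_vector_derivative r t - (a2 * w\<^sup>2) *\<^sub>R e t) (at t within {0..})"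
    proof (intro allI impI)
      fix t :: real assume t: "t \<ge> 0"
      have u: "((\<lambda>t. kappa1 (ua t) i) has_vector_derivative ua' t $ i) (at t within {0..})"
        unfolding kappa1_def
        by (rule bounded_linear.has_vector_derivative[OF bounded_linear_vec_nth ua'(1)[OF t]])
      have "((\<lambda>s. kh s $ i) has_vector_derivative (a2 * w\<^sup>2) *\<^sub>R e t) (at t within {0..})"
        using sol_i[OF t] by (simp add: e_def)
      then show "(q has_vector_derivative r t - (a2 * w\<^sup>2) *\<^sub>R e t) (at t within {0..})"
        unfolding q_def estimation_error_def r_def kappa2_def kappa3_def
        by (intro has_vector_derivative_diff has_vector_derivative_Pair has_vector_derivative_add
            has_vector_derivative_minus dis_der u g'(1) la'(1) za'(1) t)
    qed
    moreover have "\<forall>t\<ge>0. norm (r t) \<le> K"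
    proof (intro allI impI)
      fix t :: real assume t: "t \<ge> 0"
      have 1: "norm (ua' t $ i + g' t) \<le> Ku + \<bar>M\<bar>"
        using Finite_Cartesian_Product.norm_nth_le[of "ua' t" i] ua'(3)[OF t] g'(2)[OF t]
        by (intro norm_triangle_mono) auto
      have 2: "norm (- disagreement a (la' t) i - disagreement a (za' t) i) \<le> Kl * B + Kz * B"
        using dis_bound[OF la'(3)[OF t], of i] dis_bound[OF za'(3)[OF t], of i]
          norm_triangle_ineq4[of "- disagreement a (la' t) i" "disagreement a (za' t) i"] by simp
      have "norm (r t) \<le> norm (ua' t $ i + g' t)
        + (norm (- disagreement a (la' t) i - disagreement a (za' t) i) + norm (disagreement a (la' t) i))"
        unfolding r_def by (intro order_trans[OF norm_Pair_le] add_left_mono norm_Pair_le)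
      also have "\<dots> \<le> K"
        using 1 2 dis_bound[OF la'(3)[OF t], of i] unfolding K_def by linarith
      finally show "norm (r t) \<le> K" .
    qed
    ultimately show "eventually (\<lambda>t. norm (estimation_error a g ua la za x kh i t) \<le> C / w) at_top"
      unfolding q_def[symmetric] using obs w by blast
  qed
  then show ?thesis using C by blast
qed

theorem theorem2:
  fixes f :: "'m::finite \<Rightarrow> real ^ 'n \<Rightarrow> real"
    and g :: "'m \<Rightarrow> real ^ 'n \<Rightarrow> real ^ 'n"
    and d Xopt :: "real ^ 'n ^ 'm"
    and a :: "'m \<Rightarrow> 'm \<Rightarrow> real"
    and ua la za :: "real \<Rightarrow> real ^ 'n ^ 'm"
    and L a1 a2 M :: real
  assumes "connected_undirected_weights a"
    and "\<And>i. continuously_differentiable (f i)"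
    and "\<And>i. strongly_convex (f i)"
    and "\<And>i. L-lipschitz_on UNIV (grad (f i))"
    and "optimal_allocation f d Xopt"
    and "\<And>i. bounded_with_bounded_derivative (\<lambda>t. ua t $ i)"
    and "\<And>i. bounded_with_bounded_derivative (\<lambda>t. la t $ i)"
    and "\<And>i. bounded_with_bounded_derivative (\<lambda>t. za t $ i)"
    and "a1 > 0" and "a2 > 0"
  shows "\<exists>C>0. \<exists>wbar>0. \<forall>w0\<ge>wbar. \<forall>x l z gh kh.
    resilient_allocation_solution f d a g ua la za a1 a2
        (\<lambda>e. w0 *\<^sub>R e) (\<lambda>e. w0\<^sup>2 *\<^sub>R e) x l z gh kh \<longrightarrow>
    drift_rate_bounded g x M \<longrightarrow>
    Limsup at_top (\<lambda>t. ereal (norm (x t - Xopt))) \<le> ereal (C / w0)"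
proof -
  have diff: "f i differentiable (at v)" for i v
    using assms(2) by (simp add: continuously_differentiable_def)
  obtain \<mu>s where \<mu>s: "\<And>i. \<mu>s i > 0"
    "\<And>i u v. \<mu>s i * (norm (u - v))\<^sup>2 \<le> (u - v) \<bullet> (grad (f i) u - grad (f i) v)"
    using strongly_convex_grad_mono[OF diff assms(3)] by metis
  \<comment> \<open>The agents are finitely many, so the smallest of their moduli is a common
    positive one.\<close>
  define \<mu> where "\<mu> = Min (range \<mu>s)"
  have \<mu>: "\<mu> > 0" "\<And>i. \<mu> \<le> \<mu>s i"
    using \<mu>s(1) by (auto simp: \<mu>_def)
  have L: "L \<ge> 0" using lipschitz_on_nonneg[OF assms(4)] .
  obtain B where B: "B > 0" "\<And>v :: real ^ 'n ^ 'm. norm (laplacian a v) \<le> norm v * B"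
    using bounded_linear.pos_bounded[OF bounded_linear_laplacian] by blast
  obtain c where c: "c > 0"
    "\<And>v :: real ^ 'n ^ 'm. (\<Sum>j\<in>UNIV. v $ j) = 0 \<Longrightarrow> c * (norm v)\<^sup>2 \<le> v \<bullet> laplacian a v"
    using laplacian_coercive[OF assms(1)] by blast
  obtain P where P: "P > 0" "\<And>v :: real ^ 'n ^ 'm. norm (mean_free v) \<le> norm v * P"
    using bounded_linear.pos_bounded[OF bounded_linear_mean_free] by blast
  obtain Co where Co: "Co > 0" "\<And>w x l z gh kh. w > 0 \<Longrightarrow>
    resilient_allocation_solution f d a g ua la za a1 a2
        (\<lambda>e. w *\<^sub>R e) (\<lambda>e. w\<^sup>2 *\<^sub>R e) x l z gh kh \<Longrightarrow>
    drift_rate_bounded g x M \<Longrightarrow>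
    eventually (\<lambda>t. \<forall>i. norm (estimation_error a g ua la za x kh i t) \<le> Co / w) at_top"
    using estimation_error_bound[OF assms(6-10), of f d a g M] by blast
  obtain Cs where Cs: "Cs > 0" "\<And>r t0 x l z h q1 q2 q3. r > 0 \<Longrightarrow>
    \<forall>t\<ge>t0. (x has_vector_derivative - h t - l t + q1 t) (at t within {t0..}) \<and>
       (l has_vector_derivative - laplacian a (l t) - laplacian a (z t) + x t + q2 t) (at t within {t0..}) \<and>
       (z has_vector_derivative laplacian a (l t) + q3 t) (at t within {t0..}) \<and>
       z t \<bullet> laplacian a (z t) \<ge> c * (norm (z t))\<^sup>2 \<and>
       x t \<bullet> h t \<ge> \<mu> * (norm (x t))\<^sup>2 \<and> norm (h t) \<le> L * norm (x t) \<and>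
       norm (q1 t) \<le> r \<and> norm (q2 t) \<le> r \<and> norm (q3 t) \<le> r \<Longrightarrow>
    eventually (\<lambda>t. norm (x t :: real ^ 'n ^ 'm) \<le> Cs * r) at_top"
  proof -
    from saddle_flow_input_to_state[OF \<mu>(1) L less_imp_le[OF B(1)] c(1)]
    obtain C where "C > 0" and C: "\<And>(T :: real ^ 'n ^ 'm \<Rightarrow> real ^ 'n ^ 'm) r t0 x l z h q1 q2 q3.
      \<forall>v w. v \<bullet> T w = T v \<bullet> w \<Longrightarrow> \<forall>v. v \<bullet> T v \<ge> 0 \<Longrightarrow> \<forall>v. norm (T v) \<le> B * norm v \<Longrightarrow> r > 0 \<Longrightarrow>
      \<forall>t\<ge>t0. (x has_vector_derivative - h t - l t + q1 t) (at t within {t0..}) \<and>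
       (l has_vector_derivative - T (l t) - T (z t) + x t + q2 t) (at t within {t0..}) \<and>
       (z has_vector_derivative T (l t) + q3 t) (at t within {t0..}) \<and>
       z t \<bullet> T (z t) \<ge> c * (norm (z t))\<^sup>2 \<and>
       x t \<bullet> h t \<ge> \<mu> * (norm (x t))\<^sup>2 \<and> norm (h t) \<le> L * norm (x t) \<and>
       norm (q1 t) \<le> r \<and> norm (q2 t) \<le> r \<and> norm (q3 t) \<le> r \<Longrightarrow>
      eventually (\<lambda>t. norm (x t) \<le> C * r) at_top"
      by blast
    show ?thesis
    proof (rule that[OF \<open>C > 0\<close>], rule C[of "laplacian a"])
      show "\<forall>v w. v \<bullet> laplacian a w = laplacian a v \<bullet> (w :: real ^ 'n ^ 'm)"
        using laplacian_self_adjoint[OF assms(1)] by blast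
      show "\<forall>v :: real ^ 'n ^ 'm. v \<bullet> laplacian a v \<ge> 0"
        using laplacian_nonneg[OF assms(1)] by blast
      show "\<forall>v :: real ^ 'n ^ 'm. norm (laplacian a v) \<le> B * norm v"
        using B(2) by (simp add: mult.commute)
    qed
  qed
  \<comment> \<open>The common gradient at the optimum; the equilibrium multiplier is
    \<open>- p\<close> for every agent.\<close>
  obtain p where p: "\<And>i. grad (f i) (Xopt $ i) = p"
    using optimal_allocation_grad_eq[OF diff assms(5)] by blast
  \<comment> \<open>Feasibility is exactly the solvability condition for the equilibrium value
    \<open>zs\<close>.\<close>
  have "(\<Sum>i\<in>UNIV. (Xopt - d) $ i) = 0"
    using assms(5) by (simp add: optimal_allocation_def is_arg_min_def sum_subtractf)
  then obtain zs where zs: "laplacian a zs = Xopt - d"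
    using laplacian_solvable[OF assms(1)] by blast
  interpret lap: bounded_linear "laplacian a :: real ^ 'n ^ 'm \<Rightarrow> _" by (rule bounded_linear_laplacian)
  \<comment> \<open>Stacking the agents costs the factor \<open>CARD('m)\<close>, and projecting the
    third input costs \<open>P\<close>; \<open>1 + P\<close> covers both kinds of input.\<close>
  define R where "R = (1 + P) * (of_nat CARD('m) * Co)"
  have R: "R > 0" "of_nat CARD('m) * Co \<le> R" "of_nat CARD('m) * Co * P \<le> R"
  proof -
    show "R > 0" unfolding R_def using P(1) Co(1) by (intro mult_pos_pos) auto
    show "of_nat CARD('m) * Co \<le> R" "of_nat CARD('m) * Co * P \<le> R"
      using P(1) Co(1) by (simp_all add: R_def distrib_right mult.commute)
  qed
  have "Limsup at_top (\<lambda>t. ereal (norm (x t - Xopt))) \<le> ereal (Cs * R / w)"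
    if w: "w \<ge> 1"
      and sol: "resilient_allocation_solution f d a g ua la za a1 a2
        (\<lambda>e. w *\<^sub>R e) (\<lambda>e. w\<^sup>2 *\<^sub>R e) x l z gh kh"
      and drift: "drift_rate_bounded g x M"
    for w x l z gh kh
  proof -
    define q where "q i t = estimation_error a g ua la za x kh i t" for i t
    have "w > 0" using w by simp
    then have "eventually (\<lambda>t. \<forall>i. norm (q i t) \<le> Co / w) at_top"
      unfolding q_def by (rule Co(2)[OF _ sol drift])
    \<comment> \<open>From this time on the estimation errors are small, so the saddle-flow estimate
      is started at \<open>t0\<close> instead of 0.\<close>
    then obtain t0 where t0: "t0 \<ge> 0" "\<And>t i. t \<ge> t0 \<Longrightarrow> norm (q i t) \<le> Co / w"
      unfolding eventually_at_top_linorder by (metis max.cobounded1 max.cobounded2 order_trans)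
    define h where "h t = (\<chi> i. grad (f i) (x t $ i) - grad (f i) (Xopt $ i))" for t
    define q1 q2 q3 where "q1 t = (\<chi> i. fst (q i t))" and "q2 t = (\<chi> i. fst (snd (q i t)))"
      and "q3 t = mean_free (\<chi> i. snd (snd (q i t)))" for t
    \<comment> \<open>Deviations from the KKT point. For \<open>z\<close> the projected deviation is
      used, since only \<open>laplacian a z\<close> enters the dynamics and coercivity needs zero
      sum.\<close>
    define xd ld zd where "xd t = x t - Xopt" and "ld t = l t + (\<chi> i. p)"
      and "zd t = mean_free (z t - zs)" for t
    have lap_ld: "laplacian a (ld t) = laplacian a (l t)" for t
      by (simp add: ld_def lap.add)
    have lap_zd: "laplacian a (zd t) = laplacian a (z t) - (Xopt - d)" for t
      by (simp add: zd_def lap.diff zs)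
    have "eventually (\<lambda>t. norm (xd t) \<le> Cs * (R / w)) at_top"
    proof (rule Cs(2))
      show "R / w > 0" using R w by simp
      show "\<forall>t\<ge>t0. (xd has_vector_derivative - h t - ld t + q1 t) (at t within {t0..}) \<and>
       (ld has_vector_derivative - laplacian a (ld t) - laplacian a (zd t) + xd t + q2 t) (at t within {t0..}) \<and>
       (zd has_vector_derivative laplacian a (ld t) + q3 t) (at t within {t0..}) \<and>
       zd t \<bullet> laplacian a (zd t) \<ge> c * (norm (zd t))\<^sup>2 \<and>
       xd t \<bullet> h t \<ge> \<mu> * (norm (xd t))\<^sup>2 \<and> norm (h t) \<le> L * norm (xd t) \<and>
       norm (q1 t) \<le> R / w \<and> norm (q2 t) \<le> R / w \<and> norm (q3 t) \<le> R / w"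
      proof (intro allI impI conjI)
        fix t assume t: "t \<ge> t0"
        then have t': "t \<ge> 0" using t0(1) by simp
        have sub: "{t0..} \<subseteq> {0..}" using t0(1) by auto
        note sol_t = sol[unfolded resilient_allocation_solution_def, rule_format, OF t']
        have dx: "(x has_vector_derivative - h t - ld t + q1 t) (at t within {0..})"
          by (rule has_vector_derivative_vec)
            (use sol_t in \<open>simp add: h_def ld_def q1_def q_def estimation_error_def p algebra_simps\<close>)
        show "(xd has_vector_derivative - h t - ld t + q1 t) (at t within {t0..})"
          using has_vector_derivative_within_subset[OF dx sub]
          unfolding xd_def by (simp add: has_vector_derivative_diff_const)
        have dl: "(l has_vector_derivative - laplacian a (ld t) - laplacian a (zd t) + xd t + q2 t) (at t within {0..})"
          unfolding lap_ld lap_zd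
          by (rule has_vector_derivative_vec)
            (use sol_t in \<open>simp add: xd_def q2_def q_def estimation_error_def algebra_simps\<close>)
        show "(ld has_vector_derivative - laplacian a (ld t) - laplacian a (zd t) + xd t + q2 t) (at t within {t0..})"
          using has_vector_derivative_within_subset[OF dl sub]
          unfolding ld_def by (simp add: has_vector_derivative_add_const)
        have dz: "(z has_vector_derivative laplacian a (l t) + (\<chi> i. snd (snd (q i t)))) (at t within {0..})"
          by (rule has_vector_derivative_vec)
            (use sol_t in \<open>simp add: q_def estimation_error_def algebra_simps\<close>)
        \<comment> \<open>Laplacian values have zero sum, so the projection acts only on the input
          of the \<open>z\<close> equation.\<close>
        have "mean_free (laplacian a (l t)) = laplacian a (l t)"
          by (simp add: mean_free_def sum_disagreement[OF assms(1)] vec_eq_iff)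
        then have "mean_free (laplacian a (l t) + (\<chi> i. snd (snd (q i t)))) = laplacian a (ld t) + q3 t"
          by (simp add: lap_ld q3_def linear_add[OF bounded_linear.linear[OF bounded_linear_mean_free]])
        then have "(zd has_vector_derivative laplacian a (ld t) + q3 t) (at t within {0..})"
          unfolding zd_def
          using bounded_linear.has_vector_derivative[OF bounded_linear_mean_free
              has_vector_derivative_diff[OF dz has_vector_derivative_const[of zs]]] by simp
        then show "(zd has_vector_derivative laplacian a (ld t) + q3 t) (at t within {t0..})"
          using sub by (rule has_vector_derivative_within_subset)
        show "zd t \<bullet> laplacian a (zd t) \<ge> c * (norm (zd t))\<^sup>2"
          by (intro c(2)) (simp add: zd_def sum_mean_free)
        show "xd t \<bullet> h t \<ge> \<mu> * (norm (xd t))\<^sup>2"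
        proof -
          have "\<mu> * (norm (xd t))\<^sup>2 = (\<Sum>i\<in>UNIV. \<mu> * (norm (xd t $ i))\<^sup>2)"
            unfolding power2_norm_eq_inner by (subst inner_vec_def) (simp add: sum_distrib_left)
          also have "\<dots> \<le> (\<Sum>i\<in>UNIV. xd t $ i \<bullet> h t $ i)"
          proof (rule sum_mono)
            fix i
            have "\<mu> * (norm (xd t $ i))\<^sup>2 \<le> \<mu>s i * (norm (xd t $ i))\<^sup>2"
              by (intro mult_right_mono \<mu>(2)) simp
            also have "\<dots> \<le> xd t $ i \<bullet> h t $ i"
              using \<mu>s(2)[of i "x t $ i" "Xopt $ i"] by (simp add: xd_def h_def)
            finally show "\<mu> * (norm (xd t $ i))\<^sup>2 \<le> xd t $ i \<bullet> h t $ i" .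
          qed
          also have "\<dots> = xd t \<bullet> h t" by (subst inner_vec_def) simp
          finally show ?thesis .
        qed
        show "norm (h t) \<le> L * norm (xd t)"
        proof -
          have "norm (h t $ i) \<le> L * norm (xd t $ i)" for i
            using lipschitz_onD[OF assms(4)[of i], of "x t $ i" "Xopt $ i"]
            by (simp add: h_def xd_def dist_norm)
          then have "norm (h t) \<le> L2_set (\<lambda>i. L * norm (xd t $ i)) UNIV"
            unfolding norm_vec_def by (intro L2_set_mono) auto
          also have "\<dots> = L * norm (xd t)"
            unfolding norm_vec_def by (simp add: L2_set_right_distrib L)
          finally show ?thesis .
        qed
        have q_le: "norm (fst (q i t)) \<le> Co / w" "norm (fst (snd (q i t))) \<le> Co / w"
          "norm (snd (snd (q i t))) \<le> Co / w" for i
          using norm_fst_le[of "fst (q i t)" "snd (q i t)"] norm_snd_le[of "snd (q i t)" "fst (q i t)"]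
            norm_fst_le[of "fst (snd (q i t))" "snd (snd (q i t))"]
            norm_snd_le[of "snd (snd (q i t))" "fst (snd (q i t))"] t0(2)[OF t, of i]
          by simp_all
        have stack: "norm v \<le> of_nat CARD('m) * Co / w" if "\<And>i. norm (v $ i) \<le> Co / w" for v :: "real ^ 'n ^ 'm"
          using norm_stack_le[OF that] by simp
        have Rw: "of_nat CARD('m) * Co / w \<le> R / w" "of_nat CARD('m) * Co * P / w \<le> R / w"
          using R w by (intro divide_right_mono; simp)+
        show "norm (q1 t) \<le> R / w" "norm (q2 t) \<le> R / w"
          using stack[of "q1 t"] stack[of "q2 t"] q_le Rw(1) by (simp_all add: q1_def q2_def)
        have "norm (q3 t) \<le> norm (\<chi> i. snd (snd (q i t))) * P"
          unfolding q3_def by (rule P(2))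
        also have "\<dots> \<le> (of_nat CARD('m) * Co / w) * P"
          using P(1) q_le by (intro mult_right_mono stack) auto
        finally show "norm (q3 t) \<le> R / w" using Rw(2) by simp
      qed
    qed
    then show ?thesis
      by (intro Limsup_bounded) (auto simp: xd_def elim: eventually_mono)
  qed
  then show ?thesis
    \<comment> \<open>The threshold \<open>1\<close> is a default value that makes \<open>w\<close>
      positive.\<close>
    using Cs(1) R(1) by (intro exI[of _ "Cs * R"] exI[of _ 1] conjI allI impI) auto
qed

end
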